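(* Let $n\ge4$ be an integer and let $L,\mu_y,R_x,R_y,\varepsilon>0$. Put $\kappa_y=L/\mu_y$ and assume $\kappa_y\ge2$ and $\varepsilon\le\min\left\{\frac{LR_x^2}{4},\frac{\mu_yR_y^2}{36}\right\}$. Then $$\mathfrak m^{\mathrm{CC}}(\varepsilon,R_x,R_y,L,0,\mu_y)=\begin{cases}\Omega\Big(n+R_xn^{3/4}\sqrt{\frac L\varepsilon}+R_x\sqrt{\frac{nL\kappa_y}{\varepsilon}}+n^{3/4}\sqrt{\kappa_y}\log\big(\frac1\varepsilon\big)\Big), & \kappa_y=\Omega(\sqrt n),\\ \Omega\Big(n+R_xn^{3/4}\sqrt{\frac L\varepsilon}+R_x\sqrt{\frac{nL\kappa_y}{\varepsilon}}\Big), & \kappa_y=O(\sqrt n).\end{cases}$$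
   Context: Norms are Euclidean. $\mathcal P_{\mathcal X}$ is Euclidean projection onto a closed convex set $\mathcal X$. Problem: $\min_{x\in\mathcal X}\max_{y\in\mathcal Y} f(x,y)=\frac1n\sum_{i=1}^n f_i(x,y)$, with $\mathcal X\subseteq\mathbb R^{d_x}$, $\mathcal Y\subseteq\mathbb R^{d_y}$ closed and convex. A family $\{f_i\}_{i=1}^n$ of differentiable functions is $L$-average smooth if $\frac1n\sum_i\|\nabla f_i(z_1)-\nabla f_i(z_2)\|^2\le L^2\|z_1-z_2\|^2$ for all $z_1,z_2$ in the domain. $f$ is $(\mu_x,\mu_y)$-convex-concave if $f(x,y)-\frac{\mu_x}2\|x\|^2+\frac{\mu_y}2\|y\|^2$ is convex in $x$ for every fixed $y$ and concave in $y$ for every fixed $x$. PIFO algorithms. Fix an absolute constant $c_0>0$ (e.g. $c_0=2$). The oracle $h^{\mathrm{PIFO}}_{f_i}(x,y,\gamma)$, $\gamma>0$, returns $[f_i(x,y),\nabla_xf_i(x,y),-\nabla_yf_i(x,y),\mathrm{prox}^\gamma_{f_i}(x,y)]$, where $\mathrm{prox}^\gamma_{f_i}(x,y)$ is the min-max point over $(u,v)\in\mathbb R^{d_x}\times\mathbb R^{d_y}$ (min in $u$, max in $v$) of $f_i(u,v)+\frac1{2\gamma}\|x-u\|^2-\frac1{2\gamma}\|y-v\|^2$ (when $f_i$ is not convex-concave, $\gamma$ must be such that this function is convex-concave in $(u,v)$). The oracle $h^{\mathrm{FO}}_f(x,y)$ returns $[f,\nabla_xf,-\nabla_yf](x,y)$.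 A PIFO algorithm $\mathcal A$ fixes a distribution $\mathcal D$ on $\{1,\dots,n\}$ and $0<q\le c_0/n$, starts at $(x_0,y_0)=(0,0)$ with $\mathcal H=\{(x_0,y_0)\}$, and at step $t=1,2,\dots$: (i) samples $i_t\sim\mathcal D$ and queries $h^{\mathrm{PIFO}}_{f_{i_t}}$; (ii) samples $a_t\sim\mathrm{Bernoulli}(q)$ and, if $a_t=1$, queries $h^{\mathrm{FO}}_f$ and adds $(x_{t-1},y_{t-1})$ to $\mathcal H$; (iii) chooses $(\tilde x_t,\tilde y_t)$ in the linear span of $(x_0,y_0),\dots,(x_{t-1},y_{t-1})$; $\mathrm{prox}^{\gamma_j}_{f_{i_j}}(x_l,y_l)$, $(\nabla_xf_{i_j}(x_l,y_l),0)$ and $(0,-\nabla_yf_{i_j}(x_l,y_l))$ for $l<j\le t$; and $(\nabla_xf(u,v),0)$, $(0,-\nabla_yf(u,v))$ for $(u,v)\in\mathcal H$; (iv) sets $x_t=\mathcal P_{\mathcal X}(\tilde x_t)$, $y_t=\mathcal P_{\mathcal Y}(\tilde y_t)$; (v) outputs $(x_t,y_t)$ or continues with $t+1$. The pairs $(i_t,a_t)$, $t\ge1$, are mutually independent and $i_t$ is independent of $a_t$. $\mathscr A$ is the class of all PIFO algorithms. Complexity. $\mathcal F_{\mathrm{CC}}(R_x,R_y,L,\mu_x,\mu_y)$ is the set of $f=\frac1n\sum_{i=1}^nf_i:\mathcal X\times\mathcal Y\to\mathbb R$ (any dimensions $d_x,d_y$) with $\mathrm{diam}(\mathcal X)\le2R_x$,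 $\mathrm{diam}(\mathcal Y)\le2R_y$, $\{f_i\}$ $L$-average smooth and $f$ $(\mu_x,\mu_y)$-convex-concave. Let $\phi_f(x)=\max_{y\in\mathcal Y}f(x,y)$, $\psi_f(y)=\min_{x\in\mathcal X}f(x,y)$. $T(\mathcal A,f,\varepsilon)=\inf\{T\in\mathbb N:\mathbb E\phi_f(x_{\mathcal A,T})-\mathbb E\psi_f(y_{\mathcal A,T})<\varepsilon\}$, where $(x_{\mathcal A,T},y_{\mathcal A,T})$ is the point obtained by $\mathcal A$ at time-step $T-1$. $\mathfrak m^{\mathrm{CC}}(\varepsilon,R_x,R_y,L,\mu_x,\mu_y)=\inf_{\mathcal A\in\mathscr A}\sup_{f\in\mathcal F_{\mathrm{CC}}(R_x,R_y,L,\mu_x,\mu_y)}T(\mathcal A,f,\varepsilon)$; here $\mu_x=0$. Asymptotic notation. $\Omega(g)$ means at least $c\,g$ with an absolute constant $c>0$ not depending on any problem parameter ($c_0$ being a fixed constant). A case condition $\kappa=\Omega(\sqrt n)$ (resp. $O(\sqrt n)$) means $\kappa\ge c'\sqrt n$ (resp. $\kappa\le c'\sqrt n$) for an absolute constant $c'$. In lower bounds, $\log(1/\varepsilon)$ is shorthand for $\log(s/\varepsilon)$ where the scale $s>0$ may depend on the other parameters but not on $\varepsilon$. *)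

theory Defs
  imports "HOL-Probability.Probability"
begin

text \<open>
  The supremum over problem instances ranges over all dimensions, so the spaces of the
  instances cannot be types.  We use one inner product space, the finitely supported real
  sequences, and take the \<open>d\<close>-dimensional Euclidean space to be its subspace \<open>Rn d\<close> of the
  sequences supported on the first \<open>d\<close> coordinates.  Norm, distance and topology of \<open>Rn d\<close>
  are the Euclidean ones, and \<open>Rn d\<close> is closed, so that a subset of it is closed in \<open>Rn d\<close>
  iff it is closed in the ambient space.  On \<open>Rn dx \<times> Rn dy\<close> the library's product inner
  product is the Euclidean one.
\<close>

typedef fvec = "{x :: nat \<Rightarrow> real. finite {i. x i \<noteq> 0}}"
  morphisms coord Abs_fvec
  by (rule exI[of _ "\<lambda>_. 0"]) simp

setup_lifting type_definition_fvec

lemma finite_supp [simp]: "finite {i. coord x i \<noteq> 0}"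
  using coord[of x] by simp

lemma fvec_eqI: "(\<And>i. coord x i = coord y i) \<Longrightarrow> x = y"
  by (simp add: coord_inject[symmetric] ext)

instantiation fvec :: real_vector
begin

lift_definition zero_fvec :: fvec is "\<lambda>_. 0" by simp

lift_definition plus_fvec :: "fvec \<Rightarrow> fvec \<Rightarrow> fvec" is "\<lambda>x y i. x i + y i"
proof -
  fix x y :: "nat \<Rightarrow> real"
  assume "finite {i. x i \<noteq> 0}" "finite {i. y i \<noteq> 0}"
  then have "finite ({i. x i \<noteq> 0} \<union> {i. y i \<noteq> 0})" by simp
  then show "finite {i. x i + y i \<noteq> 0}"
    by (rule rev_finite_subset) auto
qed

lift_definition uminus_fvec :: "fvec \<Rightarrow> fvec" is "\<lambda>x i. - x i" by simp

lift_definition minus_fvec :: "fvec \<Rightarrow> fvec \<Rightarrow> fvec" is "\<lambda>x y i. x i - y i"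
proof -
  fix x y :: "nat \<Rightarrow> real"
  assume "finite {i. x i \<noteq> 0}" "finite {i. y i \<noteq> 0}"
  then have "finite ({i. x i \<noteq> 0} \<union> {i. y i \<noteq> 0})" by simp
  then show "finite {i. x i - y i \<noteq> 0}"
    by (rule rev_finite_subset) auto
qed

lift_definition scaleR_fvec :: "real \<Rightarrow> fvec \<Rightarrow> fvec" is "\<lambda>c x i. c * x i"
  by (erule rev_finite_subset) auto

instance
  by standard (transfer; simp add: algebra_simps)+

end

lemma coord_simps [simp]:
  "coord 0 i = 0" "coord (x + y) i = coord x i + coord y i" "coord (- x) i = - coord x i"
  "coord (x - y) i = coord x i - coord y i" "coord (c *\<^sub>R x) i = c * coord x i"
  by (transfer; simp)+

instantiation fvec :: real_inner
begin

definition inner_fvec :: "fvec \<Rightarrow> fvec \<Rightarrow> real"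
  where "inner_fvec x y = (\<Sum>i\<in>{i. coord x i \<noteq> 0}. coord x i * coord y i)"

definition norm_fvec :: "fvec \<Rightarrow> real"
  where "norm_fvec x = sqrt (inner x x)"

definition sgn_fvec :: "fvec \<Rightarrow> fvec"
  where "sgn_fvec x = x /\<^sub>R norm x"

definition dist_fvec :: "fvec \<Rightarrow> fvec \<Rightarrow> real"
  where "dist_fvec x y = norm (x - y)"

definition uniformity_fvec :: "(fvec \<times> fvec) filter"
  where "uniformity_fvec = (INF e\<in>{0<..}. principal {(x, y). dist x y < e})"

definition open_fvec :: "fvec set \<Rightarrow> bool"
  where "open_fvec U \<longleftrightarrow> (\<forall>x\<in>U. eventually (\<lambda>(x', y). x' = x \<longrightarrow> y \<in> U) uniformity)"

lemma inner_fvec_superset: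
  assumes "finite S" "{i. coord x i \<noteq> 0} \<subseteq> S"
  shows "inner x y = (\<Sum>i\<in>S. coord x i * coord y i)"
  unfolding inner_fvec_def by (rule sum.mono_neutral_left) (use assms in auto)

instance
proof
  fix x y z :: fvec and r :: real
  let ?S = "{i. coord x i \<noteq> 0} \<union> {i. coord y i \<noteq> 0}"
  have S: "finite ?S" by simp
  have x: "inner x w = (\<Sum>i\<in>?S. coord x i * coord w i)" for w
    by (rule inner_fvec_superset[OF S]) auto
  have y: "inner y w = (\<Sum>i\<in>?S. coord y i * coord w i)" for w
    by (rule inner_fvec_superset[OF S]) auto
  have xy: "inner (x + y) w = (\<Sum>i\<in>?S. coord (x + y) i * coord w i)" for w
    by (rule inner_fvec_superset[OF S]) auto
  have rx: "inner (r *\<^sub>R x) w = (\<Sum>i\<in>?S. coord (r *\<^sub>R x) i * coord w i)" for w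
    by (rule inner_fvec_superset[OF S]) auto
  show "inner x y = inner y x"
    by (simp add: x y mult.commute)
  show "inner (x + y) z = inner x z + inner y z"
    by (simp add: x y xy distrib_right sum.distrib)
  show "inner (r *\<^sub>R x) y = r * inner x y"
    by (simp add: x rx sum_distrib_left mult.assoc)
  show "0 \<le> inner x x"
    unfolding inner_fvec_def by (rule sum_nonneg) simp
  show "inner x x = 0 \<longleftrightarrow> x = 0"
  proof
    assume "inner x x = 0"
    then have "\<forall>i\<in>{i. coord x i \<noteq> 0}. coord x i * coord x i = 0"
      unfolding inner_fvec_def by (subst (asm) sum_nonneg_eq_0_iff) auto
    then show "x = 0" by (intro fvec_eqI) auto
  qed (simp add: inner_fvec_def)
qed (rule norm_fvec_def sgn_fvec_def dist_fvec_def uniformity_fvec_def open_fvec_def)+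

end

definition Rn :: "nat \<Rightarrow> fvec set"
  where "Rn d = {x. \<forall>i\<ge>d. coord x i = 0}"

lemma inner_Rn: "x \<in> Rn d \<Longrightarrow> inner x y = (\<Sum>i<d. coord x i * coord y i)"
  by (rule inner_fvec_superset) (auto simp: Rn_def not_le[symmetric])


text \<open>
  A problem instance: the dimensions, the feasible sets and the components \<open>f\<^sub>1, f\<^sub>2, \<dots>\<close>
  (only \<open>f\<^sub>1, \<dots>, f\<^sub>n\<close> are used).  The proximal oracle minimises over the whole space, and the
  starting point need not be feasible, so the domain of the components is
  \<open>Rn dx \<times> Rn dy\<close>.  Their values outside of this set are irrelevant.
\<close>

record problem =
  dimx :: nat
  dimy :: nat
  setX :: "fvec set"
  setY :: "fvec set"
  component :: "nat \<Rightarrow> fvec \<times> fvec \<Rightarrow> real"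

definition pdom :: "problem \<Rightarrow> (fvec \<times> fvec) set"
  where "pdom P = Rn (dimx P) \<times> Rn (dimy P)"

definition obj :: "nat \<Rightarrow> problem \<Rightarrow> fvec \<times> fvec \<Rightarrow> real"
  where "obj n P z = (\<Sum>i = 1..n. component P i z) / real n"

text \<open>Gradients are taken within the subspace \<open>D = Rn dx \<times> Rn dy\<close>, where they are unique.\<close>

definition grad :: "(fvec \<times> fvec) set \<Rightarrow> (fvec \<times> fvec \<Rightarrow> real) \<Rightarrow> fvec \<times> fvec \<Rightarrow> fvec \<times> fvec"
  where "grad D g z = (THE v. v \<in> D \<and> (g has_derivative (\<lambda>h. inner h v)) (at z within D))"

definition gradx :: "(fvec \<times> fvec) set \<Rightarrow> (fvec \<times> fvec \<Rightarrow> real) \<Rightarrow> fvec \<times> fvec \<Rightarrow> fvec"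
  where "gradx D g z = fst (grad D g z)"

definition grady :: "(fvec \<times> fvec) set \<Rightarrow> (fvec \<times> fvec \<Rightarrow> real) \<Rightarrow> fvec \<times> fvec \<Rightarrow> fvec"
  where "grady D g z = snd (grad D g z)"

definition average_smooth ::
    "nat \<Rightarrow> real \<Rightarrow> (fvec \<times> fvec) set \<Rightarrow> (nat \<Rightarrow> fvec \<times> fvec \<Rightarrow> real) \<Rightarrow> bool"
  where "average_smooth n L D f \<longleftrightarrow>
    (\<forall>i\<in>{1..n}. f i differentiable_on D) \<and>
    (\<forall>z1\<in>D. \<forall>z2\<in>D.
      (\<Sum>i = 1..n. (norm (grad D (f i) z1 - grad D (f i) z2))\<^sup>2) / real n
        \<le> L\<^sup>2 * (norm (z1 - z2))\<^sup>2)"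

definition convex_concave ::
    "real \<Rightarrow> real \<Rightarrow> fvec set \<Rightarrow> fvec set \<Rightarrow> (fvec \<times> fvec \<Rightarrow> real) \<Rightarrow> bool"
  where "convex_concave \<mu>x \<mu>y X Y g \<longleftrightarrow>
    (\<forall>y\<in>Y. convex_on X (\<lambda>x. g (x, y) - \<mu>x / 2 * (norm x)\<^sup>2 + \<mu>y / 2 * (norm y)\<^sup>2)) \<and>
    (\<forall>x\<in>X. concave_on Y (\<lambda>y. g (x, y) - \<mu>x / 2 * (norm x)\<^sup>2 + \<mu>y / 2 * (norm y)\<^sup>2))"

text \<open>
  Boundedness has to be stated because \<open>diameter\<close> is only meaningful for bounded sets, and
  nonemptiness because projections, maxima and minima over the feasible sets are used.
\<close>

definition F_CC :: "nat \<Rightarrow> real \<Rightarrow> real \<Rightarrow> real \<Rightarrow> real \<Rightarrow> real \<Rightarrow> problem set"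
  where "F_CC n Rx Ry L \<mu>x \<mu>y = {P.
    setX P \<subseteq> Rn (dimx P) \<and> setX P \<noteq> {} \<and> closed (setX P) \<and> convex (setX P) \<and>
    setY P \<subseteq> Rn (dimy P) \<and> setY P \<noteq> {} \<and> closed (setY P) \<and> convex (setY P) \<and>
    bounded (setX P) \<and> diameter (setX P) \<le> 2 * Rx \<and>
    bounded (setY P) \<and> diameter (setY P) \<le> 2 * Ry \<and>
    average_smooth n L (pdom P) (component P) \<and>
    convex_concave \<mu>x \<mu>y (setX P) (setY P) (obj n P)}"

text \<open>
  The feasible sets are compact and the objective is continuous, so the supremum and the
  infimum below are attained.
\<close>

definition phi :: "nat \<Rightarrow> problem \<Rightarrow> fvec \<Rightarrow> real"
  where "phi n P x = (SUP y\<in>setY P. obj n P (x, y))"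

definition psi :: "nat \<Rightarrow> problem \<Rightarrow> fvec \<Rightarrow> real"
  where "psi n P y = (INF x\<in>setX P. obj n P (x, y))"

text \<open>The library's \<open>closest_point\<close> is restricted to Heine-Borel types.\<close>

definition proj_on :: "fvec set \<Rightarrow> fvec \<Rightarrow> fvec"
  where "proj_on S a = (SOME p. p \<in> S \<and> (\<forall>q\<in>S. dist a p \<le> dist a q))"


definition prox_fun ::
    "(fvec \<times> fvec \<Rightarrow> real) \<Rightarrow> real \<Rightarrow> fvec \<times> fvec \<Rightarrow> fvec \<times> fvec \<Rightarrow> real"
  where "prox_fun g \<gamma> z w =
    g w + 1 / (2 * \<gamma>) * (norm (fst z - fst w))\<^sup>2 - 1 / (2 * \<gamma>) * (norm (snd z - snd w))\<^sup>2"

text \<open>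
  \<open>(u, v)\<close> is a min-max point of \<open>k\<close> over \<open>U \<times> V\<close>: \<open>u\<close> minimises the (possibly infinite)
  value \<open>sup\<^sub>v k (u, v)\<close>, and \<open>v\<close> maximises \<open>k (u, \<sqdot>)\<close>.
\<close>

definition minmax_point ::
    "fvec set \<Rightarrow> fvec set \<Rightarrow> (fvec \<times> fvec \<Rightarrow> real) \<Rightarrow> fvec \<times> fvec \<Rightarrow> bool"
  where "minmax_point U V k = (\<lambda>(u, v). u \<in> U \<and> v \<in> V \<and>
    (\<forall>u'\<in>U. (SUP v'\<in>V. ereal (k (u, v'))) \<le> (SUP v'\<in>V. ereal (k (u', v')))) \<and>
    (\<forall>v'\<in>V. k (u, v') \<le> k (u, v)))"

definition prox :: "problem \<Rightarrow> nat \<Rightarrow> real \<Rightarrow> fvec \<times> fvec \<Rightarrow> fvec \<times> fvec"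
  where "prox P i \<gamma> z =
    (SOME w. minmax_point (Rn (dimx P)) (Rn (dimy P)) (prox_fun (component P i) \<gamma> z) w)"

text \<open>
  Legality of a proximal query.  If \<open>f\<^sub>i\<close> is convex-concave, every \<open>\<gamma> > 0\<close> is legal.  The last
  conjunct only matters if \<open>f\<^sub>i\<close> is not convex-concave and \<open>\<gamma>\<close> is the largest value for which
  the regularised function is convex-concave, which then need not have a min-max point.
\<close>

definition prox_legal :: "problem \<Rightarrow> nat \<Rightarrow> real \<Rightarrow> fvec \<times> fvec \<Rightarrow> bool"
  where "prox_legal P i \<gamma> z \<longleftrightarrow> \<gamma> > 0 \<and>
    convex_concave 0 0 (Rn (dimx P)) (Rn (dimy P)) (prox_fun (component P i) \<gamma> z) \<and>
    (\<exists>w. minmax_point (Rn (dimx P)) (Rn (dimy P)) (prox_fun (component P i) \<gamma> z) w)"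


text \<open>
  An algorithm fixes the sampling distribution \<open>samp\<close> and the probability \<open>qprob\<close> independently
  of the problem.  The other two components are its decisions: the proximal parameter
  \<open>\<gamma>\<^sub>t\<close> and the point \<open>(x\<^sub>t, y\<^sub>t)\<close> before projection, as functions of the
  samples \<open>[(i\<^sub>1, a\<^sub>1), \<dots>, (i\<^sub>t, a\<^sub>t)]\<close> drawn so far.  For a given
  problem the oracle answers up to step \<open>t\<close> are determined by these samples, so every rule
  that evaluates the oracle answers is of this form.  As the only requirement on the chosen
  point is that it lies in the linear span prescribed below, no further restriction is
  imposed on how the decisions depend on the problem.
\<close>

record algorithm =
  samp :: "nat pmf"
  qprob :: real
  gam :: "problem \<Rightarrow> (nat \<times> bool) list \<Rightarrow> real"
  choice :: "problem \<Rightarrow> (nat \<times> bool) list \<Rightarrow> fvec \<times> fvec"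

definition sample :: "algorithm \<Rightarrow> (nat \<times> bool) pmf"
  where "sample A = pair_pmf (samp A) (bernoulli_pmf (qprob A))"

text \<open>\<open>iterate A P h\<close> is \<open>(x\<^sub>t, y\<^sub>t)\<close> after the samples \<open>h\<close>, where \<open>t\<close> is the length of \<open>h\<close>.\<close>

definition iterate :: "algorithm \<Rightarrow> problem \<Rightarrow> (nat \<times> bool) list \<Rightarrow> fvec \<times> fvec"
  where "iterate A P h = (if h = [] then (0, 0)
    else (proj_on (setX P) (fst (choice A P h)), proj_on (setY P) (snd (choice A P h))))"

text \<open>The set \<open>\<H>\<close>; the pair \<open>(i\<^sub>j, a\<^sub>j)\<close> is \<open>h ! (j - 1)\<close>.\<close>

definition full_points :: "algorithm \<Rightarrow> problem \<Rightarrow> (nat \<times> bool) list \<Rightarrow> (fvec \<times> fvec) set"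
  where "full_points A P h = {(0, 0)} \<union>
    {iterate A P (take (j - 1) h) | j. 1 \<le> j \<and> j \<le> length h \<and> snd (h ! (j - 1))}"

definition generators ::
    "nat \<Rightarrow> algorithm \<Rightarrow> problem \<Rightarrow> (nat \<times> bool) list \<Rightarrow> (fvec \<times> fvec) set"
  where "generators n A P h =
    {iterate A P (take l h) | l. l < length h} \<union>
    (\<Union>{ {prox P i (gam A P (take j h)) z,
          (gradx (pdom P) (component P i) z, 0),
          (0, - grady (pdom P) (component P i) z)}
       | i j l z. l < j \<and> j \<le> length h \<and> i = fst (h ! (j - 1)) \<and> z = iterate A P (take l h)}) \<union>
    (\<Union>w\<in>full_points A P h.
        {(gradx (pdom P) (obj n P) w, 0), (0, - grady (pdom P) (obj n P) w)})"

text \<open>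
  The class of PIFO algorithms for problems in \<open>F\<close>: on every problem in \<open>F\<close> and along every
  possible sequence of samples, the proximal queries are legal and the points are chosen in
  the prescribed linear span.
\<close>

definition PIFO :: "nat \<Rightarrow> real \<Rightarrow> problem set \<Rightarrow> algorithm set"
  where "PIFO n c0 F = {A.
    set_pmf (samp A) \<subseteq> {1..n} \<and>
    0 < qprob A \<and> qprob A \<le> 1 \<and> qprob A \<le> c0 / real n \<and>
    (\<forall>P\<in>F. \<forall>h. h \<noteq> [] \<and> set h \<subseteq> set_pmf (sample A) \<longrightarrow>
      (\<forall>l < length h. prox_legal P (fst (last h)) (gam A P h) (iterate A P (take l h))) \<and>
      choice A P h \<in> span (generators n A P h))}"

text \<open>
  \<open>replicate_pmf t (sample A)\<close> is the law of \<open>t\<close> mutually independent pairs, with \<open>i\<^sub>j\<close> and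
  \<open>a\<^sub>j\<close> independent.  The infimum of the empty set is \<open>\<infinity>\<close>.
\<close>

definition run_time :: "nat \<Rightarrow> algorithm \<Rightarrow> problem \<Rightarrow> real \<Rightarrow> enat"
  where "run_time n A P \<epsilon> = Inf {enat T | T. 1 \<le> T \<and>
    measure_pmf.expectation (replicate_pmf (T - 1) (sample A)) (\<lambda>h. phi n P (fst (iterate A P h))) -
    measure_pmf.expectation (replicate_pmf (T - 1) (sample A)) (\<lambda>h. psi n P (snd (iterate A P h)))
      < \<epsilon>}"

definition m_CC ::
    "nat \<Rightarrow> real \<Rightarrow> real \<Rightarrow> real \<Rightarrow> real \<Rightarrow> real \<Rightarrow> real \<Rightarrow> real \<Rightarrow> enat"
  where "m_CC n c0 \<epsilon> Rx Ry L \<mu>x \<mu>y =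
    (INF A\<in>PIFO n c0 (F_CC n Rx Ry L \<mu>x \<mu>y). SUP P\<in>F_CC n Rx Ry L \<mu>x \<mu>y. run_time n A P \<epsilon>)"

end

theory Submission
  imports Defs
begin

text \<open>
  For a given algorithm the hard instance puts all information into two components \<open>a\<close> and \<open>b\<close>
  that the algorithm samples rarely.  At least half of the indices have probability at most
  \<open>2 / n\<close>, so \<open>a\<close> and \<open>b\<close> can be taken among them, and a step is informative, that is, samples
  \<open>a\<close> or \<open>b\<close> or queries the full gradient, with probability at most \<open>(4 + c0) / n\<close>.
  Concentrating the structure on two components costs nothing against spreading it over all of
  them, because average smoothness bounds only the sum of the squared gradient differences.

  The instance is a chain.  With \<open>x\<^sub>-\<^sub>1 = \<beta>\<close> held constant, the objective is

  \<open>\<Sum>j<m. (lam * y\<^sub>j * (x\<^sub>j\<^sub>-\<^sub>1 - x\<^sub>j) + \<alpha> / 2 * (x\<^sub>j\<^sub>-\<^sub>1 - x\<^sub>j)\<^sup>2) - \<mu> / 2 * (norm y)\<^sup>2\<close>,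

  where \<open>a\<close> holds \<open>n\<close> times the links with even \<open>j\<close>, \<open>b\<close> those with odd \<open>j\<close>, and every
  component keeps the last term.  Two consecutive links lie in different components, so
  a gradient or a proximal step of a single component extends the set of nonzero coordinates by at
  most one, and only if it is informative.  For proximal steps this is proved without solving the
  min-max problem: no link of the component crosses a suitable cut between the coordinates, and
  truncating a min-max point at that cut cannot hurt either player (\<open>minmax_point_chain\<close>).
  Hence \<open>m - 1\<close> informative samples are needed before the last coordinate of \<open>x\<close> is
  nonzero (\<open>zero_chain.iterate_in_W\<close>), and until then the gap is at least
  \<open>(\<alpha> + lam\<^sup>2 / \<mu>) * \<beta>\<^sup>2 / (2 * m)\<close>, provided the feasible sets contain the relevant constant
  vectors (\<open>chain_fun_ge\<close>).  As the expected number of informative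
  samples grows by at most \<open>(4 + c0) / n\<close> per step, the run takes at least on the order of \<open>n * m\<close> steps
  (\<open>zero_chain.run_time_ge\<close>).

  Average smoothness allows \<open>\<alpha>\<close> and \<open>lam\<close> of order \<open>L / sqrt n\<close>, and with
  \<open>\<beta>\<close> such that the gap is \<open>2 * \<epsilon>\<close>, \<open>m\<close> may grow until the optimum
  \<open>x = (\<beta>, \<dots>, \<beta>)\<close> leaves the ball of radius \<open>Rx\<close>, which happens at
  \<open>m \<approx> Rx / 2 * sqrt ((\<alpha> + lam\<^sup>2 / \<mu>) / \<epsilon>)\<close>.  In the product \<open>n * m\<close> the summand \<open>\<alpha>\<close> yields the
  rate \<open>Rx * n powr (3/4) * sqrt (L / \<epsilon>)\<close> and \<open>lam\<^sup>2 / \<mu>\<close> yields \<open>Rx * sqrt (n * L * \<kappa> / \<epsilon>)\<close>.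

  The term \<open>n\<close> comes from a chain with a single bilinear link \<open>lam * y * (Rx - x)\<close> whose feasible
  \<open>y\<close> is one point far from the starting point (\<open>hidden_slope_instance\<close>).  The initial full
  gradient is taken at \<open>y = 0\<close> and shows no slope in \<open>x\<close>, while the objective on the feasible set
  is as steep as desired.

  The logarithmic term is of lower order as \<open>\<epsilon> \<longlonglongrightarrow> 0\<close>: with the scale
  \<open>s = Rx\<^sup>2 * L / (4 * sqrt n)\<close> the inequality \<open>ln t \<le> 2 * sqrt t\<close> bounds it by
  \<open>Rx * sqrt (n * L * \<kappa> / \<epsilon>)\<close> for every \<open>\<epsilon>\<close>.
\<close>

section \<open>Euclidean balls and projections inside the space of finite sequences\<close>

lemma coord_eq_Rn: "x \<in> Rn d \<Longrightarrow> d \<le> i \<Longrightarrow> coord x i = 0"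
  by (simp add: Rn_def)

lemma Rn_mono: "d \<le> e \<Longrightarrow> Rn d \<subseteq> Rn e"
  by (auto simp: Rn_def)

lemma zero_in_Rn [simp]: "0 \<in> Rn d"
  by (simp add: Rn_def)

lemma subspace_Rn: "subspace (Rn d)"
  by (auto simp: subspace_def Rn_def)

lemma norm_Rn: "x \<in> Rn d \<Longrightarrow> (norm x)\<^sup>2 = (\<Sum>i<d. (coord x i)\<^sup>2)"
  unfolding power2_norm_eq_inner by (simp add: inner_Rn power2_eq_square)

lemma abs_coord_le_norm: "\<bar>coord x i\<bar> \<le> norm x"
proof -
  have "(coord x i)\<^sup>2 \<le> (norm x)\<^sup>2"
  proof (cases "coord x i = 0")
    case False
    have "(coord x i)\<^sup>2 \<le> (\<Sum>j\<in>{j. coord x j \<noteq> 0}. (coord x j)\<^sup>2)"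
      by (rule member_le_sum) (use False in auto)
    then show ?thesis
      unfolding power2_norm_eq_inner by (simp add: inner_fvec_def power2_eq_square)
  qed simp
  then show ?thesis
    using abs_le_square_iff[of "coord x i" "norm x"] by simp
qed

lemma bounded_linear_coord: "bounded_linear (\<lambda>x. coord x i)"
  by (rule bounded_linear_intro[where K = 1]) (use abs_coord_le_norm in auto)

lemma closed_Rn: "closed (Rn d)"
proof -
  have "Rn d = (\<Inter>i\<in>{d..}. {x. coord x i = 0})"
    by (auto simp: Rn_def)
  moreover have "closed {x. coord x i = 0}" for i
    by (intro closed_Collect_eq bounded_linear.continuous_on[OF bounded_linear_coord] continuous_intros)
  ultimately show ?thesis
    by auto
qed

definition vec :: "nat \<Rightarrow> (nat \<Rightarrow> real) \<Rightarrow> fvec"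
  where "vec d f = Abs_fvec (\<lambda>i. if i < d then f i else 0)"

lemma coord_vec [simp]: "coord (vec d f) i = (if i < d then f i else 0)"
proof -
  have "finite {i. (if i < d then f i else 0) \<noteq> 0}"
    by (rule finite_subset[of _ "{..<d}"]) auto
  then show ?thesis
    unfolding vec_def by (subst Abs_fvec_inverse) auto
qed

lemma vec_in_Rn [simp]: "vec d f \<in> Rn d"
  by (simp add: Rn_def)

lemma norm_vec: "(norm (vec d f))\<^sup>2 = (\<Sum>i<d. (f i)\<^sup>2)"
  by (simp add: norm_Rn[OF vec_in_Rn])

lemma Rn_Int: "Rn a \<inter> Rn b = Rn (min a b)"
  by (auto simp: Rn_def min_def)

definition Bn :: "nat \<Rightarrow> real \<Rightarrow> fvec set"
  where "Bn m r = cball 0 r \<inter> Rn m"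

lemma Bn_props:
  assumes "r \<ge> 0"
  shows "Bn m r \<subseteq> Rn m" "0 \<in> Bn m r" "Bn m r \<noteq> {}" "closed (Bn m r)" "convex (Bn m r)"
    "bounded (Bn m r)" "diameter (Bn m r) \<le> 2 * r"
proof -
  show 0: "0 \<in> Bn m r"
    using assms by (simp add: Bn_def)
  show "Bn m r \<subseteq> Rn m" "closed (Bn m r)" "convex (Bn m r)" "bounded (Bn m r)"
    by (auto simp: Bn_def closed_Rn subspace_imp_convex[OF subspace_Rn] intro: closed_Int convex_Int bounded_subset)
  show "Bn m r \<noteq> {}"
    using 0 by auto
  show "diameter (Bn m r) \<le> 2 * r"
  proof (rule diameter_le)
    show "Bn m r \<noteq> {} \<or> 0 \<le> 2 * r"
      using assms by simp
    fix x y assume "x \<in> Bn m r" "y \<in> Bn m r"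
    then show "norm (x - y) \<le> 2 * r"
      using norm_triangle_ineq4[of x y] by (simp add: Bn_def)
  qed
qed

text \<open>
  The nearest point of the ball is a multiple of \<open>a\<close>, so projecting does not create nonzero
  coordinates; this is what makes balls suitable feasible sets for zero-chains.
\<close>

lemma proj_on_Bn:
  assumes r: "r \<ge> 0" and a: "a \<in> Rn k" and k: "k \<le> m"
  shows "proj_on (Bn m r) a \<in> Bn k r"
proof -
  define p where "p = (if norm a \<le> r then a else (r / norm a) *\<^sub>R a)"
  have pk: "p \<in> Rn k"
    using a by (simp add: p_def subspace_scale subspace_Rn)
  have pn: "norm p \<le> r"
    using r by (auto simp: p_def)
  have p: "p \<in> Bn m r"
    using pk pn Rn_mono[OF k] by (auto simp: Bn_def)
  have best: "dist a p \<le> dist a q" if "q \<in> Bn m r" for q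
  proof (cases "norm a \<le> r")
    case False
    then have "a \<noteq> 0"
      using r by auto
    have "a - p = (1 - r / norm a) *\<^sub>R a"
      using False by (simp add: p_def algebra_simps)
    then have "norm (a - p) = (1 - r / norm a) * norm a"
      using False r by (simp add: divide_le_eq)
    also have "\<dots> = norm a - r"
      using \<open>a \<noteq> 0\<close> by (simp add: left_diff_distrib)
    finally have "dist a p = norm a - r"
      by (simp add: dist_norm)
    also have "\<dots> \<le> norm a - norm q"
      using that by (simp add: Bn_def)
    also have "\<dots> \<le> dist a q"
      by (simp add: dist_norm norm_triangle_ineq2)
    finally show ?thesis .
  qed (simp add: p_def)
  have "proj_on (Bn m r) a = p"
    unfolding proj_on_def
  proof (rule some_equality)
    show "p \<in> Bn m r \<and> (\<forall>q\<in>Bn m r. dist a p \<le> dist a q)"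
      using p best by blast
  next
    fix p' assume "p' \<in> Bn m r \<and> (\<forall>q\<in>Bn m r. dist a p' \<le> dist a q)"
    then show "p' = p"
      using any_closest_point_unique[of "Bn m r" p' p a] Bn_props[OF r] p best by blast
  qed
  then show ?thesis
    using pk pn by (simp add: Bn_def)
qed

lemma proj_on_singleton: "proj_on {p} a = p"
  unfolding proj_on_def by (rule some_equality) auto

section \<open>Zero-chains: progress is bounded by the number of informative samples\<close>

text \<open>
  All min-max points are considered, because \<open>prox\<close> selects an unspecified one of them.
\<close>

definition answers_in :: "problem \<Rightarrow> nat \<Rightarrow> fvec \<times> fvec \<Rightarrow> (fvec \<times> fvec) set \<Rightarrow> bool"
  where "answers_in P i z V \<longleftrightarrow>
    (gradx (pdom P) (component P i) z, 0) \<in> V \<and> (0, - grady (pdom P) (component P i) z) \<in> V \<and>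
    (\<forall>\<gamma> w. \<gamma> > 0 \<longrightarrow>
      minmax_point (Rn (dimx P)) (Rn (dimy P)) (prox_fun (component P i) \<gamma> z) w \<longrightarrow> w \<in> V)"

definition full_answers_in :: "nat \<Rightarrow> problem \<Rightarrow> fvec \<times> fvec \<Rightarrow> (fvec \<times> fvec) set \<Rightarrow> bool"
  where "full_answers_in n P z V \<longleftrightarrow>
    (gradx (pdom P) (obj n P) z, 0) \<in> V \<and> (0, - grady (pdom P) (obj n P) z) \<in> V"

definition informative :: "nat set \<Rightarrow> nat \<times> bool \<Rightarrow> bool"
  where "informative S s \<longleftrightarrow> fst s \<in> S \<or> snd s"

text \<open>
  The sets \<open>U k\<close> confine the span from which the algorithm chooses after \<open>k\<close> informative samples,
  and the \<open>W k\<close> confine the projected iterates.  They are distinguished since the span is a subspace, whereas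
  the gap is under control only at feasible points and at the starting point.  The last assumption reflects that the full gradient at the starting point is
  available from the beginning.
\<close>

locale zero_chain =
  fixes n :: nat and P :: problem and S :: "nat set"
    and U W :: "nat \<Rightarrow> (fvec \<times> fvec) set"
  assumes subspace_U: "subspace (U k)"
    and U_step: "U k \<subseteq> U (Suc k)"
    and W_U: "W k \<subseteq> U k"
    and zero_W: "(0, 0) \<in> W 0"
    and proj_W: "z \<in> U k \<Longrightarrow> (proj_on (setX P) (fst z), proj_on (setY P) (snd z)) \<in> W k"
    and inactive: "z \<in> W k \<Longrightarrow> i \<in> {1..n} \<Longrightarrow> i \<notin> S \<Longrightarrow> answers_in P i z (U k)"
    and active: "z \<in> W k \<Longrightarrow> i \<in> {1..n} \<Longrightarrow> answers_in P i z (U (Suc k))"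
    and full: "z \<in> W k \<Longrightarrow> full_answers_in n P z (U (Suc k))"
    and full_zero: "full_answers_in n P (0, 0) (U 0)"
begin

abbreviation level :: "(nat \<times> bool) list \<Rightarrow> nat"
  where "level h \<equiv> length (filter (informative S) h)"

lemma U_mono: "k \<le> l \<Longrightarrow> U k \<subseteq> U l"
  by (induction l rule: dec_induct) (use U_step in auto)

lemma level_take_mono: "k \<le> l \<Longrightarrow> level (take k h) \<le> level (take l h)"
  by (metis append_take_drop_id filter_append le_add1 length_append min.absorb1 take_take)

lemma level_take_Suc:
  assumes "j < length h"
  shows "level (take (Suc j) h) = level (take j h) + (if informative S (h ! j) then 1 else 0)"
  using assms by (simp add: take_Suc_conv_app_nth)

text \<open>
  A generator computed from an earlier iterate with the \<open>j\<close>-th sample lies one level higher than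
  that iterate only if the \<open>j\<close>-th sample is informative, and then this sample also counts for the
  present level.
\<close>

lemma iterate_in_W:
  assumes A: "A \<in> PIFO n c0 F" and P: "P \<in> F" and h: "set h \<subseteq> set_pmf (sample A)"
  shows "iterate A P h \<in> W (level h)"
  using h
proof (induction "length h" arbitrary: h rule: less_induct)
  case less
  show ?case
  proof (cases "h = []")
    case True
    then show ?thesis
      using zero_W by (simp add: iterate_def)
  next
    case False
    let ?U = "U (level h)"
    have samp: "fst ` set_pmf (sample A) \<subseteq> {1..n}"
      using A by (auto simp: PIFO_def sample_def)
    have pref: "iterate A P (take l h) \<in> W (level (take l h))" if "l < length h" for l
      using less.hyps[of "take l h"] less.prems that by (auto dest: in_set_takeD)
    have prefU: "iterate A P (take l h) \<in> ?U" if "l < length h" for l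
      using pref[OF that] W_U U_mono[OF level_take_mono[of l "length h" h]] that by auto
    have comp: "prox P i (gam A P (take j h)) z \<in> ?U \<and>
          (gradx (pdom P) (component P i) z, 0) \<in> ?U \<and> (0, - grady (pdom P) (component P i) z) \<in> ?U"
      if j: "l < j" "j \<le> length h" and i: "i = fst (h ! (j - 1))" and z: "z = iterate A P (take l h)" for i j l z
    proof -
      obtain j' where j': "j = Suc j'" "j' < length h" "l \<le> j'"
        using j by (cases j) auto
      have ii: "i \<in> {1..n}"
      proof -
        have "h ! j' \<in> set_pmf (sample A)"
          using less.prems nth_mem[OF j'(2)] by blast
        then have "fst (h ! j') \<in> fst ` set_pmf (sample A)"
          by (rule imageI)
        then show ?thesis
          using samp i j'(1) by auto
      qed
      have zW: "z \<in> W (level (take l h))"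
        using pref z j by simp
      have le: "level (take l h) + (if informative S (h ! j') then 1 else 0) \<le> level h"
        using level_take_Suc[OF j'(2)] level_take_mono[OF j'(3), of h] level_take_mono[of "Suc j'" "length h" h] j'
        by simp
      have ans: "answers_in P i z ?U"
      proof (cases "i \<in> S")
        case True
        then have "Suc (level (take l h)) \<le> level h"
          using le i j' by (simp add: informative_def)
        with active[OF zW ii] U_mono show ?thesis
          unfolding answers_in_def by blast
      next
        case False
        have "level (take l h) \<le> level h"
          using le by simp
        with inactive[OF zW ii False] U_mono show ?thesis
          unfolding answers_in_def by blast
      qed
      have "take j h \<noteq> []" "set (take j h) \<subseteq> set_pmf (sample A)"
        using j less.prems False by (auto dest: in_set_takeD)
      with A P have legal: "\<forall>l < length (take j h). prox_legal P (fst (last (take j h))) (gam A P (take j h))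
          (iterate A P (take l (take j h)))"
        unfolding PIFO_def by blast
      have "last (take j h) = h ! (j - 1)"
        using j' by (simp add: take_Suc_conv_app_nth)
      \<comment> \<open>legality of the query provides the min-max point that \<open>prox\<close> selects\<close>
      moreover have "l < length (take j h)" "take l (take j h) = take l h"
        using j by simp_all
      ultimately have leg: "prox_legal P i (gam A P (take j h)) z"
        using legal[rule_format, of l] by (simp add: i z)
      then have "minmax_point (Rn (dimx P)) (Rn (dimy P)) (prox_fun (component P i) (gam A P (take j h)) z)
            (prox P i (gam A P (take j h)) z)"
        unfolding prox_def prox_legal_def by (blast intro: someI_ex)
      with ans leg show ?thesis
        unfolding answers_in_def prox_legal_def by blast
    qed
    have fullU: "(gradx (pdom P) (obj n P) z, 0) \<in> ?U \<and> (0, - grady (pdom P) (obj n P) z) \<in> ?U"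
      if "z \<in> full_points A P h" for z
    proof -
      have "full_answers_in n P z ?U"
        using that unfolding full_points_def
      proof (elim UnE CollectE exE conjE)
        assume "z \<in> {(0, 0)}"
        then show ?thesis
          using full_zero U_mono[of 0 "level h"] unfolding full_answers_in_def by auto
      next
        fix j assume j: "z = iterate A P (take (j - 1) h)" "1 \<le> j" "j \<le> length h" "snd (h ! (j - 1))"
        then obtain j' where j': "j = Suc j'" "j' < length h"
          by (cases j) auto
        have "Suc (level (take j' h)) \<le> level h"
          using level_take_Suc[OF j'(2)] level_take_mono[of "Suc j'" "length h" h] j j'
          by (simp add: informative_def)
        with full[OF pref[OF j'(2)]] U_mono j j' show ?thesis
          unfolding full_answers_in_def by (simp add: subset_iff)
      qed
      then show ?thesis
        by (simp add: full_answers_in_def)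
    qed
    have "generators n A P h \<subseteq> ?U"
      unfolding generators_def
    proof (intro Un_least subsetI)
      fix x assume "x \<in> {iterate A P (take l h) |l. l < length h}"
      then show "x \<in> ?U"
        using prefU by auto
    next
      fix x assume "x \<in> \<Union> {{prox P i (gam A P (take j h)) z, (gradx (pdom P) (component P i) z, 0),
                 (0, - grady (pdom P) (component P i) z)} |i j l z.
               l < j \<and> j \<le> length h \<and> i = fst (h ! (j - 1)) \<and> z = iterate A P (take l h)}"
      then show "x \<in> ?U"
        using comp by blast
    next
      fix x assume "x \<in> (\<Union>w\<in>full_points A P h. {(gradx (pdom P) (obj n P) w, 0), (0, - grady (pdom P) (obj n P) w)})"
      then show "x \<in> ?U"
        using fullU by blast
    qed
    then have "span (generators n A P h) \<subseteq> ?U"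
      by (intro span_minimal subspace_U)
    moreover have "choice A P h \<in> span (generators n A P h)"
      using A P False less.prems unfolding PIFO_def by blast
    ultimately have "choice A P h \<in> ?U"
      by blast
    from proj_W[OF this] False show ?thesis
      by (simp add: iterate_def)
  qed
qed

end

section \<open>The expected number of informative samples\<close>

lemma expectation_length_filter:
  assumes "finite (set_pmf p)"
  shows "measure_pmf.expectation (replicate_pmf t p) (\<lambda>h. real (length (filter Q h))) = t * measure_pmf.prob p {x. Q x}"
proof (induction t)
  case 0
  then show ?case by simp
next
  case (Suc t)
  have fin: "finite (set_pmf (replicate_pmf t p))"
    using finite_lists_length_eq[OF assms, of t] by (simp add: set_replicate_pmf lists_eq_set)
  let ?R = "replicate_pmf t p"
  have "replicate_pmf (Suc t) p = map_pmf (\<lambda>(x, h). x # h) (pair_pmf p ?R)"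
    by (simp add: pair_pmf_def map_bind_pmf)
  then have "measure_pmf.expectation (replicate_pmf (Suc t) p) (\<lambda>h. real (length (filter Q h)))
      = measure_pmf.expectation (pair_pmf p ?R) (\<lambda>z. (of_bool (Q (fst z)) :: real) + real (length (filter Q (snd z))))"
    by (simp add: case_prod_beta if_distrib) (rule arg_cong2[where f = "integral\<^sup>L"], simp_all add: fun_eq_iff)
  also have "\<dots> = measure_pmf.expectation (pair_pmf p ?R) (\<lambda>z. of_bool (Q (fst z)) :: real)
      + measure_pmf.expectation (pair_pmf p ?R) (\<lambda>z. real (length (filter Q (snd z))))"
    using assms fin by (intro Bochner_Integration.integral_add integrable_measure_pmf_finite) auto
  also have "measure_pmf.expectation (pair_pmf p ?R) (\<lambda>z. of_bool (Q (fst z)) :: real)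
      = measure_pmf.expectation p (indicator {x. Q x} :: _ \<Rightarrow> real)"
    using expectation_pair_pmf_fst[of p ?R "\<lambda>x. of_bool (Q x) :: real"]
    by (simp add: indicator_def[abs_def])
  also have "\<dots> = measure_pmf.prob p {x. Q x}"
    by simp
  also have "measure_pmf.expectation (pair_pmf p ?R) (\<lambda>z. real (length (filter Q (snd z)))) = t * measure_pmf.prob p {x. Q x}"
    using Suc.IH expectation_pair_pmf_snd[of p ?R "\<lambda>h. real (length (filter Q h))"] by (rule trans[rotated])
  finally show ?case
    by (simp add: algebra_simps)
qed

text \<open>
  Fewer than \<open>n / 2\<close> indices can have probability above \<open>2 / n\<close>.
\<close>

lemma two_rare_indices:
  fixes p :: "nat pmf" and n :: nat
  assumes "n \<ge> 4"
  obtains a b where "a \<in> {1..n}" "b \<in> {1..n}" "a \<noteq> b" "pmf p a \<le> 2 / n" "pmf p b \<le> 2 / n"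
proof -
  define G where "G = {i \<in> {1..n}. pmf p i \<le> 2 / n}"
  have n: "real n > 0"
    using assms by simp
  have "card ({1..n} - G) * (2 / n) \<le> (\<Sum>i\<in>{1..n} - G. pmf p i)"
    by (rule sum_bounded_below) (auto simp: G_def)
  also have "\<dots> = measure_pmf.prob p ({1..n} - G)"
    by (simp add: measure_measure_pmf_finite)
  also have "\<dots> \<le> 1"
    by simp
  finally have "2 * real (card ({1..n} - G)) \<le> n"
    using n by (simp add: field_simps)
  moreover have "card ({1..n} - G) = n - card G"
    by (subst card_Diff_subset) (auto simp: G_def)
  moreover have "card G \<le> card {1..n}"
    by (rule card_mono) (auto simp: G_def)
  ultimately have "2 \<le> card G"
    using assms by simp
  then obtain a b where "a \<in> G" "b \<in> G" "a \<noteq> b"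
    by (metis card_le_Suc0_iff_eq card.infinite not_less_eq_eq numeral_2_eq_2 zero_le)
  then show ?thesis
    using that by (auto simp: G_def)
qed

lemma prob_informative_le:
  assumes "0 \<le> qprob A" "qprob A \<le> 1"
  shows "measure_pmf.prob (sample A) {s. informative {a, b} s} \<le> pmf (samp A) a + pmf (samp A) b + qprob A"
proof -
  let ?p = "measure_pmf.prob (sample A)"
  have fst: "?p {s. fst s = i} = pmf (samp A) i" for i
  proof -
    have "pmf (samp A) i = measure_pmf.prob (map_pmf fst (sample A)) {i}"
      by (simp add: sample_def map_fst_pair_pmf measure_pmf_single)
    also have "\<dots> = ?p {s. fst s = i}"
      unfolding measure_map_pmf by (rule arg_cong[where f = ?p]) auto
    finally show ?thesis ..
  qed
  have snd: "?p {s. snd s} = qprob A"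
  proof -
    have "qprob A = measure_pmf.prob (map_pmf snd (sample A)) {True}"
      using assms by (simp add: sample_def map_snd_pair_pmf measure_pmf_single)
    also have "\<dots> = ?p {s. snd s}"
      unfolding measure_map_pmf by (rule arg_cong[where f = ?p]) auto
    finally show ?thesis ..
  qed
  have "?p {s. informative {a, b} s} = ?p ({s. fst s = a} \<union> {s. fst s = b} \<union> {s. snd s})"
    by (rule arg_cong[where f = ?p]) (auto simp: informative_def)
  also have "\<dots> \<le> ?p ({s. fst s = a} \<union> {s. fst s = b}) + ?p {s. snd s}"
    by (rule measure_Un_le) auto
  also have "\<dots> \<le> ?p {s. fst s = a} + ?p {s. fst s = b} + ?p {s. snd s}"
    by (intro add_right_mono measure_Un_le) auto
  finally show ?thesis
    by (simp add: fst snd)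
qed

lemma ereal_le_enat_iff: "ereal r \<le> ereal_of_enat k \<longleftrightarrow> enat (nat \<lceil>r\<rceil>) \<le> k"
  by (cases k) (auto simp: ceiling_le_iff nat_le_iff)

text \<open>
  The gap after the samples \<open>h\<close> is at least \<open>2 * \<epsilon> * (1 - level h / M)\<close>, for \<open>level h \<ge> M\<close> because
  this is not positive.  Being affine in the level, this bound can be averaged directly, and it stays
  at least \<open>\<epsilon>\<close> as long as the expected level is at most \<open>M / 2\<close>.
\<close>

lemma (in zero_chain) run_time_ge:
  assumes A: "A \<in> PIFO n c0 F" and P: "P \<in> F" and S: "S = {a, b}" and n: "n > 0" and c0: "c0 \<ge> 0"
    and rare: "pmf (samp A) a \<le> 2 / n" "pmf (samp A) b \<le> 2 / n"
    and \<epsilon>: "\<epsilon> > 0" and M: "M > 0"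
    and gap_nonneg: "\<And>k x y. (x, y) \<in> W k \<Longrightarrow> phi n P x - psi n P y \<ge> 0"
    and gap: "\<And>k x y. (x, y) \<in> W k \<Longrightarrow> k < M \<Longrightarrow> phi n P x - psi n P y \<ge> 2 * \<epsilon>"
  shows "ereal (n * M / (2 * (4 + c0))) \<le> ereal_of_enat (run_time n A P \<epsilon>)"
proof -
  let ?gap = "\<lambda>h. phi n P (fst (iterate A P h)) - psi n P (snd (iterate A P h))"
  have fin: "finite (set_pmf (sample A))"
  proof -
    have "set_pmf (sample A) \<subseteq> {1..n} \<times> UNIV"
      using A by (auto simp: PIFO_def sample_def)
    then show ?thesis
      by (rule finite_subset) auto
  qed
  have finr: "finite (set_pmf (replicate_pmf t (sample A)))" for t
    using finite_lists_length_eq[OF fin, of t] by (simp add: set_replicate_pmf lists_eq_set)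
  note integrable = integrable_measure_pmf_finite[OF finr]
  let ?q = "measure_pmf.prob (sample A) {s. informative S s}"
  have q: "?q \<le> (4 + c0) / n"
  proof -
    have "0 \<le> qprob A" "qprob A \<le> 1" "qprob A \<le> c0 / n"
      using A by (auto simp: PIFO_def)
    then have "?q \<le> 2 / n + 2 / n + c0 / n"
      using prob_informative_le[of A a b] rare unfolding S by linarith
    also have "\<dots> = (4 + c0) / n"
      by (simp add: add_divide_distrib)
    finally show ?thesis .
  qed
  have "n * M / (2 * (4 + c0)) \<le> T"
    if T: "1 \<le> T" and less: "measure_pmf.expectation (replicate_pmf (T - 1) (sample A)) (\<lambda>h. phi n P (fst (iterate A P h))) -
    measure_pmf.expectation (replicate_pmf (T - 1) (sample A)) (\<lambda>h. psi n P (snd (iterate A P h))) < \<epsilon>" for T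
  proof -
    let ?E = "measure_pmf.expectation (replicate_pmf (T - 1) (sample A))"
    have "2 * \<epsilon> * (1 - real (T - 1) * ?q / M) = ?E (\<lambda>h. 2 * \<epsilon> * (1 - real (level h) / M))"
    proof -
      have "?E (\<lambda>h. 1 - real (level h) / M) = ?E (\<lambda>_. 1) - ?E (\<lambda>h. real (level h) / M)"
        by (intro Bochner_Integration.integral_diff integrable)
      also have "\<dots> = 1 - real (T - 1) * ?q / M"
        using expectation_length_filter[OF fin, of "T - 1" "informative S"] by simp
      finally show ?thesis
        by simp
    qed
    also have "\<dots> \<le> ?E ?gap"
    proof (rule integral_mono_AE[OF integrable integrable], rule AE_pmfI)
      fix h assume "h \<in> set_pmf (replicate_pmf (T - 1) (sample A))"
      then have "iterate A P h \<in> W (level h)"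
        by (intro iterate_in_W[OF A P]) (auto simp: set_replicate_pmf)
      then have z: "(fst (iterate A P h), snd (iterate A P h)) \<in> W (level h)"
        by simp
      show "2 * \<epsilon> * (1 - real (level h) / M) \<le> ?gap h"
      proof (cases "level h < M")
        case True
        have "2 * \<epsilon> * (1 - real (level h) / M) \<le> 2 * \<epsilon> * 1"
          using \<epsilon> by (intro mult_left_mono) auto
        with gap[OF z True] show ?thesis by simp
      next
        case False
        then have "1 - real (level h) / M \<le> 0"
          using M by (simp add: field_simps)
        with \<epsilon> have "2 * \<epsilon> * (1 - real (level h) / M) \<le> 0"
          by (intro mult_nonneg_nonpos) auto
        with gap_nonneg[OF z] show ?thesis by simp
      qed
    qed
    also have "\<dots> < \<epsilon>"
      using less by (subst Bochner_Integration.integral_diff[OF integrable integrable])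
    finally have "\<epsilon> * (2 * (1 - real (T - 1) * ?q / M)) < \<epsilon> * 1"
      by (simp only: mult.assoc mult.left_commute mult_1_right)
    then have "2 * (1 - real (T - 1) * ?q / M) < 1"
      using \<epsilon> by (simp only: mult_less_cancel_left_pos)
    moreover have "M < 2 * u" if "2 * (1 - u / M) < 1" for u :: real
      using that M by (simp add: field_simps)
    ultimately have "M < 2 * (real (T - 1) * ?q)"
      by blast
    also have "\<dots> \<le> 2 * (T * ((4 + c0) / n))"
      using q by (intro mult_left_mono mult_mono) auto
    finally show ?thesis
      using n c0 by (simp add: field_simps)
  qed
  then have "enat (nat \<lceil>n * M / (2 * (4 + c0))\<rceil>) \<le> run_time n A P \<epsilon>"
    unfolding run_time_def by (intro Inf_greatest) (auto simp: nat_le_iff ceiling_le_iff)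
  then show ?thesis
    by (simp only: ereal_le_enat_iff)
qed

lemma m_CC_ge:
  assumes "\<And>A. A \<in> PIFO n c0 (F_CC n Rx Ry L \<mu>x \<mu>y) \<Longrightarrow>
    \<exists>P\<in>F_CC n Rx Ry L \<mu>x \<mu>y. ereal r \<le> ereal_of_enat (run_time n A P \<epsilon>)"
  shows "ereal r \<le> ereal_of_enat (m_CC n c0 \<epsilon> Rx Ry L \<mu>x \<mu>y)"
  unfolding m_CC_def ereal_le_enat_iff
proof (rule INF_greatest)
  fix A assume "A \<in> PIFO n c0 (F_CC n Rx Ry L \<mu>x \<mu>y)"
  from assms[OF this] obtain P where "P \<in> F_CC n Rx Ry L \<mu>x \<mu>y" "enat (nat \<lceil>r\<rceil>) \<le> run_time n A P \<epsilon>"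
    unfolding ereal_le_enat_iff by blast
  then show "enat (nat \<lceil>r\<rceil>) \<le> (SUP P\<in>F_CC n Rx Ry L \<mu>x \<mu>y. run_time n A P \<epsilon>)"
    by (rule SUP_upper2)
qed

section \<open>The chain function and its gradient\<close>

text \<open>
  Within a subspace \<open>D\<close> a derivative determines the gradient only up to vectors orthogonal to \<open>D\<close>;
  restricting \<open>g\<close> to the line through \<open>z\<close> in the direction of the difference of two candidates
  \<open>v, v' \<in> D\<close> shows that they agree.
\<close>

lemma grad_eqI:
  assumes D: "subspace D" and z: "z \<in> D" and v: "v \<in> D"
    and der: "(g has_derivative (\<lambda>h. inner h v)) (at z within D)"
  shows "grad D g z = v"
  unfolding grad_def
proof (rule the_equality)
  show "v \<in> D \<and> (g has_derivative (\<lambda>h. inner h v)) (at z within D)"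
    using v der by simp
next
  fix v' assume v': "v' \<in> D \<and> (g has_derivative (\<lambda>h. inner h v')) (at z within D)"
  define d where "d = v' - v"
  have d: "d \<in> D"
    using v v' D by (simp add: d_def subspace_diff)
  have line: "((\<lambda>t. z + t *\<^sub>R d) has_derivative (\<lambda>t. t *\<^sub>R d)) (at 0)"
    by (auto intro!: derivative_eq_intros)
  have sub: "range (\<lambda>t. z + t *\<^sub>R d) \<subseteq> D"
    using D z d by (auto intro!: subspace_add subspace_scale)
  have restr: "((\<lambda>t. g (z + t *\<^sub>R d)) has_derivative (\<lambda>t. inner (t *\<^sub>R d) u)) (at 0)"
    if "(g has_derivative (\<lambda>h. inner h u)) (at z within D)" for u
  proof -
    have "(g has_derivative (\<lambda>h. inner h u)) (at (z + 0 *\<^sub>R d) within range (\<lambda>t. z + t *\<^sub>R d))"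
      using has_derivative_subset[OF that sub] by simp
    from diff_chain_within[OF line this] show ?thesis
      by (simp add: o_def)
  qed
  have "(\<lambda>t. inner (t *\<^sub>R d) v) = (\<lambda>t. inner (t *\<^sub>R d) v')"
    using restr[of v] restr[of v'] der v' has_derivative_unique by blast
  then have "inner (1 *\<^sub>R d) v = inner (1 *\<^sub>R d) v'"
    by (rule fun_cong)
  then have "inner d d = 0"
    unfolding d_def by (simp add: inner_diff_right)
  then show "v' = v"
    by (simp add: d_def)
qed

text \<open>
  The chain starts with the constant \<open>\<beta>\<close> in the place of the coordinate with index \<open>-1\<close>.  For \<open>\<beta> = 0\<close>
  this function and \<open>link\<close> are the linear parts of the affine functions for general \<open>\<beta>\<close>.
\<close>

definition prev :: "real \<Rightarrow> fvec \<Rightarrow> nat \<Rightarrow> real"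
  where "prev \<beta> x j = (case j of 0 \<Rightarrow> \<beta> | Suc i \<Rightarrow> coord x i)"

definition link :: "real \<Rightarrow> fvec \<Rightarrow> nat \<Rightarrow> real"
  where "link \<beta> x j = prev \<beta> x j - coord x j"

text \<open>
  The weights \<open>w\<close> select the links: the components have weights \<open>n\<close> and \<open>0\<close>, and their average has
  weights \<open>1\<close>, so that one function covers the components as well as the objective.
\<close>

definition chain_fun ::
    "nat \<Rightarrow> real \<Rightarrow> real \<Rightarrow> real \<Rightarrow> real \<Rightarrow> (nat \<Rightarrow> real) \<Rightarrow> fvec \<times> fvec \<Rightarrow> real"
  where "chain_fun m \<beta> \<alpha> lam \<nu> w z =
    (\<Sum>j<m. w j * (lam * coord (snd z) j * link \<beta> (fst z) j + \<alpha> / 2 * (link \<beta> (fst z) j)\<^sup>2))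
    - \<nu> / 2 * (norm (snd z))\<^sup>2"

lemma link_diff: "link \<beta> x j - link \<beta> x' j = link 0 (x - x') j"
  by (simp add: link_def prev_def split: nat.split)

lemma summation_by_parts:
  "(\<Sum>j<m. r j * link 0 h j) = (\<Sum>i<m. coord h i * (r (Suc i) - r i)) - r m * prev 0 h m"
  by (induction m) (auto simp: link_def prev_def algebra_simps)

text \<open>
  The derivative in the link \<open>j\<close>, extended by \<open>0\<close> beyond the end of the chain; in this form the
  gradient in \<open>x\<close> is a difference of neighbouring forces.
\<close>

definition chain_force ::
    "nat \<Rightarrow> real \<Rightarrow> real \<Rightarrow> real \<Rightarrow> (nat \<Rightarrow> real) \<Rightarrow> fvec \<times> fvec \<Rightarrow> nat \<Rightarrow> real"
  where "chain_force m \<beta> \<alpha> lam w z j =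
    (if j < m then w j * (lam * coord (snd z) j + \<alpha> * link \<beta> (fst z) j) else 0)"

definition chain_grad ::
    "nat \<Rightarrow> real \<Rightarrow> real \<Rightarrow> real \<Rightarrow> real \<Rightarrow> (nat \<Rightarrow> real) \<Rightarrow> fvec \<times> fvec \<Rightarrow> fvec \<times> fvec"
  where "chain_grad m \<beta> \<alpha> lam \<nu> w z =
    (vec m (\<lambda>i. chain_force m \<beta> \<alpha> lam w z (Suc i) - chain_force m \<beta> \<alpha> lam w z i),
     vec m (\<lambda>i. w i * lam * link \<beta> (fst z) i) - \<nu> *\<^sub>R snd z)"

lemma has_derivative_link:
  "((\<lambda>z. link \<beta> (fst z) j) has_derivative (\<lambda>h. link 0 (fst h) j)) F"
  unfolding link_def prev_def
  by (cases j) (auto intro!: derivative_eq_intros bounded_linear.has_derivative[OF bounded_linear_coord])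

lemma chain_has_derivative:
  "(chain_fun m \<beta> \<alpha> lam \<nu> w has_derivative (\<lambda>h. inner h (chain_grad m \<beta> \<alpha> lam \<nu> w z))) (at z within D)"
proof -
  let ?r = "chain_force m \<beta> \<alpha> lam w z"
  let ?l = "link \<beta> (fst z)"
  have link: "((\<lambda>z. link \<beta> (fst z) j) has_derivative (\<lambda>h. link 0 (fst h) j)) (at z within D)" for j
    by (rule has_derivative_link)
  have y: "((\<lambda>z. coord (snd z) j) has_derivative (\<lambda>h. coord (snd h) j)) (at z within D)" for j
    by (rule bounded_linear.has_derivative[OF bounded_linear_coord has_derivative_snd[OF has_derivative_ident]])
  have "((\<lambda>z. w j * (lam * coord (snd z) j * link \<beta> (fst z) j + \<alpha> / 2 * (link \<beta> (fst z) j)\<^sup>2))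
      has_derivative (\<lambda>h. w j * (lam * coord (snd h) j * ?l j + lam * coord (snd z) j * link 0 (fst h) j
              + \<alpha> * ?l j * link 0 (fst h) j))) (at z within D)" for j
    unfolding power2_eq_square
    by (rule has_derivative_eq_rhs,
        (rule link y has_derivative_mult_right has_derivative_add has_derivative_mult)+)
       (auto simp: algebra_simps)
  from has_derivative_sum[OF this]
  have "((\<lambda>z. \<Sum>j<m. w j * (lam * coord (snd z) j * link \<beta> (fst z) j + \<alpha> / 2 * (link \<beta> (fst z) j)\<^sup>2))
      has_derivative (\<lambda>h. \<Sum>j<m. w j * (lam * coord (snd h) j * ?l j + lam * coord (snd z) j * link 0 (fst h) j
              + \<alpha> * ?l j * link 0 (fst h) j))) (at z within D)" .
  moreover have "((\<lambda>z. \<nu> / 2 * (norm (snd z))\<^sup>2) has_derivative (\<lambda>h. \<nu> * inner (snd z) (snd h))) (at z within D)"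
    for z :: "fvec \<times> fvec"
    unfolding power2_norm_eq_inner
    by (auto intro!: derivative_eq_intros simp: inner_commute)
  ultimately have "(chain_fun m \<beta> \<alpha> lam \<nu> w has_derivative
      (\<lambda>h. (\<Sum>j<m. w j * (lam * coord (snd h) j * ?l j + lam * coord (snd z) j * link 0 (fst h) j
              + \<alpha> * ?l j * link 0 (fst h) j)) - \<nu> * inner (snd z) (snd h))) (at z within D)"
    unfolding chain_fun_def by (rule has_derivative_diff)
  moreover have "(\<Sum>j<m. w j * (lam * coord (snd h) j * ?l j + lam * coord (snd z) j * link 0 (fst h) j
              + \<alpha> * ?l j * link 0 (fst h) j)) - \<nu> * inner (snd z) (snd h)
      = inner h (chain_grad m \<beta> \<alpha> lam \<nu> w z)" for h
  proof -
    have "(\<Sum>j<m. ?r j * link 0 (fst h) j) = inner (fst h) (fst (chain_grad m \<beta> \<alpha> lam \<nu> w z))"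
      unfolding summation_by_parts chain_grad_def
      by (simp add: inner_commute[of "fst h"] inner_Rn[OF vec_in_Rn] mult.commute)
         (simp add: chain_force_def)
    moreover have "(\<Sum>j<m. w j * lam * ?l j * coord (snd h) j) = inner (snd h) (vec m (\<lambda>i. w i * lam * ?l i))"
      by (subst inner_commute) (simp add: inner_Rn[OF vec_in_Rn])
    moreover have "(\<Sum>j<m. w j * (lam * coord (snd h) j * ?l j + lam * coord (snd z) j * link 0 (fst h) j
              + \<alpha> * ?l j * link 0 (fst h) j))
        = (\<Sum>j<m. ?r j * link 0 (fst h) j) + (\<Sum>j<m. w j * lam * ?l j * coord (snd h) j)"
      unfolding sum.distrib[symmetric]
      by (rule sum.cong) (auto simp: chain_force_def algebra_simps)
    ultimately show ?thesis
      by (cases h) (simp add: chain_grad_def inner_diff_right inner_commute inner_Pair)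
  qed
  ultimately show ?thesis
    by simp
qed

lemma grad_chain:
  assumes "z \<in> Rn m \<times> Rn m"
  shows "grad (Rn m \<times> Rn m) (chain_fun m \<beta> \<alpha> lam \<nu> w) z = chain_grad m \<beta> \<alpha> lam \<nu> w z"
proof (rule grad_eqI[OF subspace_Times[OF subspace_Rn subspace_Rn] assms _ chain_has_derivative])
  show "chain_grad m \<beta> \<alpha> lam \<nu> w z \<in> Rn m \<times> Rn m"
    using assms by (auto simp: chain_grad_def intro!: subspace_diff subspace_scale subspace_Rn)
qed

section \<open>Average smoothness and convexity of the chain problem\<close>

lemma sum_link_squares: "(\<Sum>j<m. (link 0 x j)\<^sup>2) \<le> 4 * (norm x)\<^sup>2" if "x \<in> Rn m"
proof -
  have "(\<Sum>j<m. (link 0 x j)\<^sup>2) \<le> (\<Sum>j<m. 2 * (prev 0 x j)\<^sup>2 + 2 * (coord x j)\<^sup>2)"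
    unfolding link_def by (intro sum_mono) (smt (verit) power2_sum power2_diff zero_le_power2)
  also have "\<dots> = 2 * (\<Sum>j<m. (prev 0 x j)\<^sup>2) + 2 * (norm x)\<^sup>2"
    using that by (simp add: norm_Rn sum.distrib sum_distrib_left)
  also have "(\<Sum>j<m. (prev 0 x j)\<^sup>2) \<le> (\<Sum>j<Suc m. (prev 0 x j)\<^sup>2)"
    by simp
  also have "\<dots> = (norm x)\<^sup>2"
    using that by (subst sum.lessThan_Suc_shift) (simp add: prev_def norm_Rn)
  finally show ?thesis
    by simp
qed

lemma chain_grad_diff:
  "chain_grad m \<beta> \<alpha> lam \<nu> w z1 - chain_grad m \<beta> \<alpha> lam \<nu> w z2 = chain_grad m 0 \<alpha> lam \<nu> w (z1 - z2)"
  by (cases z1; cases z2)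
     (auto simp: chain_grad_def chain_force_def link_diff[of \<beta>, symmetric] algebra_simps intro!: fvec_eqI)

text \<open>
  The bound is linear in the squared weights.  Summed over the components it therefore depends only
  on \<open>\<Sum>i. (w i j)\<^sup>2\<close>, which is \<open>n\<^sup>2\<close> for each link \<open>j\<close> no matter which component holds it.
\<close>

lemma norm_chain_grad_le:
  assumes z: "z \<in> Rn m \<times> Rn m"
  shows "(norm (chain_grad m 0 \<alpha> lam \<nu> w z))\<^sup>2 \<le>
    (\<Sum>j<m. (w j)\<^sup>2 * (8 * lam\<^sup>2 * (coord (snd z) j)\<^sup>2 + (8 * \<alpha>\<^sup>2 + 2 * lam\<^sup>2) * (link 0 (fst z) j)\<^sup>2))
    + 2 * \<nu>\<^sup>2 * (norm (snd z))\<^sup>2"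
proof -
  obtain x y where xy: "z = (x, y)" by (cases z)
  let ?r = "chain_force m 0 \<alpha> lam w z"
  have sq: "(a - b)\<^sup>2 \<le> 2 * a\<^sup>2 + 2 * b\<^sup>2" for a b :: real
    by (smt (verit) power2_sum power2_diff zero_le_power2)
  have sq': "(a + b)\<^sup>2 \<le> 2 * a\<^sup>2 + 2 * b\<^sup>2" for a b :: real
    using sq[of a "- b"] by simp
  have "(\<Sum>i<m. (?r (Suc i) - ?r i)\<^sup>2) \<le> (\<Sum>i<m. 2 * (?r (Suc i))\<^sup>2 + 2 * (?r i)\<^sup>2)"
    by (intro sum_mono sq)
  also have "\<dots> = 2 * (\<Sum>i<m. (?r (Suc i))\<^sup>2) + 2 * (\<Sum>i<m. (?r i)\<^sup>2)"
    by (simp add: sum.distrib sum_distrib_left)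
  also have "(\<Sum>i<m. (?r (Suc i))\<^sup>2) \<le> (\<Sum>i<Suc m. (?r i)\<^sup>2)"
    by (subst sum.lessThan_Suc_shift) simp
  also have "\<dots> = (\<Sum>i<m. (?r i)\<^sup>2)"
    by (simp add: chain_force_def)
  finally have 1: "(\<Sum>i<m. (?r (Suc i) - ?r i)\<^sup>2) \<le> (\<Sum>i<m. 4 * (?r i)\<^sup>2)"
    by (simp add: sum_distrib_left)
  also have "\<dots> \<le> (\<Sum>j<m. (w j)\<^sup>2 * (8 * lam\<^sup>2 * (coord y j)\<^sup>2 + 8 * \<alpha>\<^sup>2 * (link 0 x j)\<^sup>2))"
  proof (rule sum_mono)
    fix j assume "j \<in> {..<m}"
    then have "4 * (?r j)\<^sup>2 = (w j)\<^sup>2 * (4 * (lam * coord y j + \<alpha> * link 0 x j)\<^sup>2)"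
      by (simp add: chain_force_def xy power_mult_distrib)
    also have "\<dots> \<le> (w j)\<^sup>2 * (4 * (2 * (lam * coord y j)\<^sup>2 + 2 * (\<alpha> * link 0 x j)\<^sup>2))"
      by (intro mult_left_mono sq') auto
    finally show "4 * (?r j)\<^sup>2 \<le> (w j)\<^sup>2 * (8 * lam\<^sup>2 * (coord y j)\<^sup>2 + 8 * \<alpha>\<^sup>2 * (link 0 x j)\<^sup>2)"
      by (simp add: power_mult_distrib mult.assoc)
  qed
  finally have gx: "(norm (fst (chain_grad m 0 \<alpha> lam \<nu> w z)))\<^sup>2
      \<le> (\<Sum>j<m. (w j)\<^sup>2 * (8 * lam\<^sup>2 * (coord y j)\<^sup>2 + 8 * \<alpha>\<^sup>2 * (link 0 x j)\<^sup>2))"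
    by (simp add: chain_grad_def norm_vec)
  have "snd (chain_grad m 0 \<alpha> lam \<nu> w z) \<in> Rn m"
    using z by (auto simp: chain_grad_def intro!: subspace_diff subspace_scale subspace_Rn)
  from norm_Rn[OF this]
  have "(norm (snd (chain_grad m 0 \<alpha> lam \<nu> w z)))\<^sup>2 = (\<Sum>j<m. (w j * lam * link 0 x j - \<nu> * coord y j)\<^sup>2)"
    by (simp add: chain_grad_def xy)
  also have "\<dots> \<le> (\<Sum>j<m. 2 * (w j * lam * link 0 x j)\<^sup>2 + 2 * (\<nu> * coord y j)\<^sup>2)"
    by (intro sum_mono sq)
  also have "\<dots> = (\<Sum>j<m. (w j)\<^sup>2 * (2 * lam\<^sup>2 * (link 0 x j)\<^sup>2)) + 2 * \<nu>\<^sup>2 * (norm y)\<^sup>2"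
    using z by (auto simp add: xy norm_Rn sum.distrib sum_distrib_left power_mult_distrib mult_ac)
  finally have gy: "(norm (snd (chain_grad m 0 \<alpha> lam \<nu> w z)))\<^sup>2
      \<le> (\<Sum>j<m. (w j)\<^sup>2 * (2 * lam\<^sup>2 * (link 0 x j)\<^sup>2)) + 2 * \<nu>\<^sup>2 * (norm y)\<^sup>2" .
  have "(norm (chain_grad m 0 \<alpha> lam \<nu> w z))\<^sup>2
      = (norm (fst (chain_grad m 0 \<alpha> lam \<nu> w z)))\<^sup>2 + (norm (snd (chain_grad m 0 \<alpha> lam \<nu> w z)))\<^sup>2"
    by (subst norm_prod_def) simp
  also note add_mono[OF gx gy]
  finally show ?thesis
    by (simp add: xy sum.distrib[symmetric] algebra_simps)
qed

definition chain_weight :: "nat \<Rightarrow> nat \<Rightarrow> nat \<Rightarrow> nat \<Rightarrow> nat \<Rightarrow> real"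
  where "chain_weight n a b i j =
    (if i = a \<and> even j \<or> i = b \<and> odd j then real n else 0)"

definition chain_problem ::
    "nat \<Rightarrow> nat \<Rightarrow> nat \<Rightarrow> nat \<Rightarrow> real \<Rightarrow> real \<Rightarrow> real \<Rightarrow> real \<Rightarrow> fvec set \<Rightarrow> fvec set \<Rightarrow> problem"
  where "chain_problem n a b m \<beta> \<alpha> lam \<nu> X Y = \<lparr>dimx = m, dimy = m, setX = X, setY = Y,
    component = (\<lambda>i. chain_fun m \<beta> \<alpha> lam \<nu> (chain_weight n a b i))\<rparr>"

lemma chain_problem_simps [simp]:
  "dimx (chain_problem n a b m \<beta> \<alpha> lam \<nu> X Y) = m"
  "dimy (chain_problem n a b m \<beta> \<alpha> lam \<nu> X Y) = m"
  "setX (chain_problem n a b m \<beta> \<alpha> lam \<nu> X Y) = X"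
  "setY (chain_problem n a b m \<beta> \<alpha> lam \<nu> X Y) = Y"
  "component (chain_problem n a b m \<beta> \<alpha> lam \<nu> X Y) i = chain_fun m \<beta> \<alpha> lam \<nu> (chain_weight n a b i)"
  "pdom (chain_problem n a b m \<beta> \<alpha> lam \<nu> X Y) = Rn m \<times> Rn m"
  by (simp_all add: chain_problem_def pdom_def)

lemma sum_chain_weight:
  assumes "a \<in> {1..n}" "b \<in> {1..n}" "a \<noteq> b"
  shows "(\<Sum>i = 1..n. chain_weight n a b i j) = real n"
    and "(\<Sum>i = 1..n. (chain_weight n a b i j)\<^sup>2) = (real n)\<^sup>2"
proof -
  define c where "c = (if even j then a else b)"
  have c: "c \<in> {1..n}"
    using assms by (simp add: c_def)
  have eq: "chain_weight n a b i j = (if c = i then real n else 0)" for i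
    using assms(3) by (auto simp: chain_weight_def c_def)
  have sq: "(if c = i then real n else 0)\<^sup>2 = (if c = i then (real n)\<^sup>2 else 0)" for i
    by simp
  show "(\<Sum>i = 1..n. chain_weight n a b i j) = real n"
    unfolding eq by (subst sum.delta') (use c in auto)
  show "(\<Sum>i = 1..n. (chain_weight n a b i j)\<^sup>2) = (real n)\<^sup>2"
    unfolding eq sq by (subst sum.delta') (use c in auto)
qed

lemma obj_chain:
  assumes "a \<in> {1..n}" "b \<in> {1..n}" "a \<noteq> b"
  shows "obj n (chain_problem n a b m \<beta> \<alpha> lam \<nu> X Y) = chain_fun m \<beta> \<alpha> lam \<nu> (\<lambda>_. 1)"
proof
  fix z
  let ?t = "\<lambda>j. lam * coord (snd z) j * link \<beta> (fst z) j + \<alpha> / 2 * (link \<beta> (fst z) j)\<^sup>2"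
  have n: "real n > 0"
    using assms by auto
  have "(\<Sum>i = 1..n. \<Sum>j<m. chain_weight n a b i j * ?t j) = (\<Sum>j<m. (\<Sum>i = 1..n. chain_weight n a b i j) * ?t j)"
    by (subst sum.swap) (simp add: sum_distrib_right)
  also have "\<dots> = real n * (\<Sum>j<m. ?t j)"
    unfolding sum_chain_weight(1)[OF assms] by (simp only: sum_distrib_left)
  finally have *: "(\<Sum>i = 1..n. \<Sum>j<m. chain_weight n a b i j * ?t j) = real n * (\<Sum>j<m. ?t j)" .
  show "obj n (chain_problem n a b m \<beta> \<alpha> lam \<nu> X Y) z = chain_fun m \<beta> \<alpha> lam \<nu> (\<lambda>_. 1) z"
    unfolding obj_def chain_problem_simps chain_fun_def sum_subtractf *
    using n by (simp add: field_simps)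
qed

lemma chain_average_smooth:
  assumes ab: "a \<in> {1..n}" "b \<in> {1..n}" "a \<noteq> b"
    and 1: "8 * real n * lam\<^sup>2 + 2 * \<nu>\<^sup>2 \<le> L\<^sup>2"
    and 2: "real n * (32 * \<alpha>\<^sup>2 + 8 * lam\<^sup>2) \<le> L\<^sup>2"
  shows "average_smooth n L (Rn m \<times> Rn m) (component (chain_problem n a b m \<beta> \<alpha> lam \<nu> X Y))"
  unfolding average_smooth_def chain_problem_simps
proof (intro conjI ballI)
  fix i
  show "chain_fun m \<beta> \<alpha> lam \<nu> (chain_weight n a b i) differentiable_on Rn m \<times> Rn m"
    unfolding differentiable_on_def differentiable_def by (blast intro: chain_has_derivative)
next
  fix z1 z2 assume z: "z1 \<in> Rn m \<times> Rn m" "z2 \<in> Rn m \<times> Rn m"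
  obtain x y where xy: "z1 - z2 = (x, y)" by (cases "z1 - z2")
  have d: "z1 - z2 \<in> Rn m \<times> Rn m"
    using z by (intro subspace_diff subspace_Times subspace_Rn) auto
  then have xR: "x \<in> Rn m" and yR: "y \<in> Rn m"
    using xy by auto
  have n: "real n > 0"
    using ab by auto
  let ?t = "\<lambda>j. 8 * lam\<^sup>2 * (coord y j)\<^sup>2 + (8 * \<alpha>\<^sup>2 + 2 * lam\<^sup>2) * (link 0 x j)\<^sup>2"
  have "(\<Sum>i = 1..n. (norm (grad (Rn m \<times> Rn m) (chain_fun m \<beta> \<alpha> lam \<nu> (chain_weight n a b i)) z1
        - grad (Rn m \<times> Rn m) (chain_fun m \<beta> \<alpha> lam \<nu> (chain_weight n a b i)) z2))\<^sup>2)
      \<le> (\<Sum>i = 1..n. (\<Sum>j<m. (chain_weight n a b i j)\<^sup>2 * ?t j) + 2 * \<nu>\<^sup>2 * (norm y)\<^sup>2)"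
    unfolding grad_chain[OF z(1)] grad_chain[OF z(2)] chain_grad_diff
    by (rule sum_mono) (use norm_chain_grad_le[OF d] xy in auto)
  also have "\<dots> = (\<Sum>j<m. (\<Sum>i = 1..n. (chain_weight n a b i j)\<^sup>2) * ?t j) + real n * (2 * \<nu>\<^sup>2 * (norm y)\<^sup>2)"
    by (simp add: sum.distrib sum_distrib_right) (rule sum.swap)
  also have "\<dots> = (real n)\<^sup>2 * (8 * lam\<^sup>2 * (norm y)\<^sup>2 + (8 * \<alpha>\<^sup>2 + 2 * lam\<^sup>2) * (\<Sum>j<m. (link 0 x j)\<^sup>2))
      + real n * (2 * \<nu>\<^sup>2 * (norm y)\<^sup>2)"
    unfolding sum_chain_weight(2)[OF ab] norm_Rn[OF yR]
    by (simp add: sum.distrib sum_distrib_left algebra_simps)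
  also have "\<dots> \<le> (real n)\<^sup>2 * (8 * lam\<^sup>2 * (norm y)\<^sup>2 + (8 * \<alpha>\<^sup>2 + 2 * lam\<^sup>2) * (4 * (norm x)\<^sup>2))
      + real n * (2 * \<nu>\<^sup>2 * (norm y)\<^sup>2)"
    by (intro add_mono mult_left_mono order_refl sum_link_squares xR) auto
  also have "\<dots> = real n * ((8 * real n * lam\<^sup>2 + 2 * \<nu>\<^sup>2) * (norm y)\<^sup>2
      + (real n * (32 * \<alpha>\<^sup>2 + 8 * lam\<^sup>2)) * (norm x)\<^sup>2)"
    by (simp add: algebra_simps power2_eq_square)
  also have "\<dots> \<le> real n * (L\<^sup>2 * (norm y)\<^sup>2 + L\<^sup>2 * (norm x)\<^sup>2)"
    by (intro mult_left_mono add_mono mult_right_mono 1 2) auto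
  also have "\<dots> = real n * (L\<^sup>2 * (norm (z1 - z2))\<^sup>2)"
    unfolding xy norm_prod_def by (simp add: algebra_simps)
  finally show "(\<Sum>i = 1..n. (norm (grad (Rn m \<times> Rn m) (chain_fun m \<beta> \<alpha> lam \<nu> (chain_weight n a b i)) z1
        - grad (Rn m \<times> Rn m) (chain_fun m \<beta> \<alpha> lam \<nu> (chain_weight n a b i)) z2))\<^sup>2) / real n
      \<le> L\<^sup>2 * (norm (z1 - z2))\<^sup>2"
    using n by (simp add: divide_le_eq mult.commute)
qed

lemma convex_on_affine_square:
  assumes "\<alpha> \<ge> 0" "convex X"
  shows "convex_on X (\<lambda>x. c * link \<beta> x j + \<alpha> / 2 * (link \<beta> x j)\<^sup>2)"
proof (rule convex_onI)
  fix t :: real and x x' assume t: "0 < t" "t < 1"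
  let ?q = "\<lambda>s. c * s + \<alpha> / 2 * s\<^sup>2"
  have "link \<beta> ((1 - t) *\<^sub>R x + t *\<^sub>R x') j = (1 - t) * link \<beta> x j + t * link \<beta> x' j"
    by (cases j) (auto simp: link_def prev_def algebra_simps)
  moreover have "?q ((1 - t) * p + t * q) \<le> (1 - t) * ?q p + t * ?q q" for p q
  proof -
    have "(1 - t) * ?q p + t * ?q q - ?q ((1 - t) * p + t * q) = \<alpha> / 2 * (t * (1 - t) * (p - q)\<^sup>2)"
      by (simp add: field_simps power2_eq_square)
    also have "\<dots> \<ge> 0"
      using t assms by (intro mult_nonneg_nonneg) auto
    finally show ?thesis by simp
  qed
  ultimately show "?q (link \<beta> ((1 - t) *\<^sub>R x + t *\<^sub>R x') j) \<le> (1 - t) * ?q (link \<beta> x j) + t * ?q (link \<beta> x' j)"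
    by simp
qed (rule assms)

lemma convex_on_sum_lessThan:
  fixes f :: "nat \<Rightarrow> 'v::real_vector \<Rightarrow> real"
  assumes "convex X" "\<And>j. convex_on X (f j)"
  shows "convex_on X (\<lambda>x. \<Sum>j<m. f j x)"
proof (induction m)
  case 0
  then show ?case
    using assms by (simp add: convex_on_def)
next
  case (Suc m)
  then show ?case
    using assms by (simp add: convex_on_add)
qed

lemma chain_convex_in_x:
  assumes "\<alpha> \<ge> 0" "convex X"
  shows "convex_on X (\<lambda>x. chain_fun m \<beta> \<alpha> lam \<nu> (\<lambda>_. 1) (x, y) + c)"
proof -
  have "convex_on X (\<lambda>x. (\<Sum>j<m. lam * coord y j * link \<beta> x j + \<alpha> / 2 * (link \<beta> x j)\<^sup>2) + (c - \<nu> / 2 * (norm y)\<^sup>2))"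
    using assms
    by (intro convex_on_add convex_on_sum_lessThan convex_on_affine_square) (auto simp: convex_on_def algebra_simps simp flip: distrib_right)
  then show ?thesis
    by (simp add: chain_fun_def algebra_simps)
qed

lemma chain_concave_in_y:
  assumes "convex Y"
  shows "concave_on Y (\<lambda>y. chain_fun m \<beta> \<alpha> lam \<nu> (\<lambda>_. 1) (x, y) + \<nu> / 2 * (norm y)\<^sup>2)"
  unfolding concave_on_def
proof (rule convex_onI)
  fix t :: real and y y'
  show "- (chain_fun m \<beta> \<alpha> lam \<nu> (\<lambda>_. 1) (x, (1 - t) *\<^sub>R y + t *\<^sub>R y') + \<nu> / 2 * (norm ((1 - t) *\<^sub>R y + t *\<^sub>R y'))\<^sup>2)
    \<le> (1 - t) * - (chain_fun m \<beta> \<alpha> lam \<nu> (\<lambda>_. 1) (x, y) + \<nu> / 2 * (norm y)\<^sup>2)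
      + t * - (chain_fun m \<beta> \<alpha> lam \<nu> (\<lambda>_. 1) (x, y') + \<nu> / 2 * (norm y')\<^sup>2)"
    unfolding chain_fun_def
    by (simp add: field_simps sum.distrib sum_subtractf sum_distrib_left flip: sum_divide_distrib)
qed (rule assms)

lemma chain_problem_in_F_CC:
  assumes ab: "a \<in> {1..n}" "b \<in> {1..n}" "a \<noteq> b"
    and "\<alpha> \<ge> 0" "8 * real n * lam\<^sup>2 + 2 * \<nu>\<^sup>2 \<le> L\<^sup>2" "real n * (32 * \<alpha>\<^sup>2 + 8 * lam\<^sup>2) \<le> L\<^sup>2"
    and "X \<subseteq> Rn m" "X \<noteq> {}" "closed X" "convex X" "bounded X" "diameter X \<le> 2 * Rx"
    and "Y \<subseteq> Rn m" "Y \<noteq> {}" "closed Y" "convex Y" "bounded Y" "diameter Y \<le> 2 * Ry"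
    and conc: "\<And>x. x \<in> X \<Longrightarrow> concave_on Y (\<lambda>y. chain_fun m \<beta> \<alpha> lam \<nu> (\<lambda>_. 1) (x, y) + \<mu> / 2 * (norm y)\<^sup>2)"
  shows "chain_problem n a b m \<beta> \<alpha> lam \<nu> X Y \<in> F_CC n Rx Ry L 0 \<mu>"
  using assms chain_convex_in_x[of \<alpha> X m \<beta> lam \<nu>] chain_average_smooth[of a n b lam \<nu> L \<alpha> m \<beta> X Y]
  by (simp add: F_CC_def convex_concave_def obj_chain[OF ab])

section \<open>Oracle answers on the chain problem\<close>

definition trunc :: "nat \<Rightarrow> fvec \<Rightarrow> fvec"
  where "trunc K x = vec K (coord x)"

lemma coord_trunc [simp]: "coord (trunc K x) i = (if i < K then coord x i else 0)"
  by (simp add: trunc_def)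

lemma trunc_in_Rn: "trunc K x \<in> Rn K"
  by (simp add: trunc_def)

lemma trunc_preserves_Rn: "x \<in> Rn m \<Longrightarrow> trunc K x \<in> Rn m"
  by (simp add: Rn_def)

lemma norm_diff_square:
  fixes a b :: "'a::real_inner"
  shows "(norm (a - b))\<^sup>2 = (norm a)\<^sup>2 + (norm b)\<^sup>2 - 2 * inner a b"
  unfolding power2_norm_eq_inner by (simp add: inner_diff_left inner_diff_right inner_commute)

lemma trunc_pythagoras:
  assumes "x \<in> Rn K"
  shows "(norm (x - u))\<^sup>2 = (norm (x - trunc K u))\<^sup>2 + (norm (u - trunc K u))\<^sup>2"
proof -
  have R: "x - trunc K u \<in> Rn K"
    using assms by (intro subspace_diff subspace_Rn trunc_in_Rn)
  have "inner (x - trunc K u) (u - trunc K u) = 0"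
    unfolding inner_Rn[OF R] by (simp add: sum.neutral)
  moreover have "x - u = (x - trunc K u) - (u - trunc K u)"
    by simp
  ultimately show ?thesis
    using norm_diff_square[of "x - trunc K u" "u - trunc K u"] by simp
qed

text \<open>
  The hypothesis \<open>cut\<close> says that no link with nonzero weight crosses the cut at \<open>K\<close> in \<open>x\<close> and at
  \<open>K'\<close> in \<open>y\<close>.  Links before the cut have the same value on both sides.  Links behind it vanish on
  the left, where their \<open>x\<close>-part is removed, and are nonnegative on the right, where their
  \<open>y\<close>-part is removed so that only the square remains.  The two extra terms are gained in the
  proximal penalties, since \<open>x\<close> and \<open>y\<close> have no coordinates behind the cut.
\<close>

lemma prox_fun_chain_trunc:
  assumes w: "\<And>j. w j \<ge> 0" and \<alpha>: "\<alpha> \<ge> 0" and \<nu>: "\<nu> \<ge> 0" and \<gamma>: "\<gamma> > 0"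
    and x: "x \<in> Rn K" and y: "y \<in> Rn K'"
    and cut: "\<And>j. j < m \<Longrightarrow> w j \<noteq> 0 \<Longrightarrow> j < K \<and> j < K' \<or> K < j \<and> K' \<le> j"
  shows "prox_fun (chain_fun m \<beta> \<alpha> lam \<nu> w) \<gamma> (x, y) (trunc K u, v)
      + 1 / (2 * \<gamma>) * (norm (u - trunc K u))\<^sup>2 + 1 / (2 * \<gamma>) * (norm (v - trunc K' v))\<^sup>2
    \<le> prox_fun (chain_fun m \<beta> \<alpha> lam \<nu> w) \<gamma> (x, y) (u, trunc K' v)"
proof -
  let ?t = "\<lambda>u v j. lam * coord v j * link \<beta> u j + \<alpha> / 2 * (link \<beta> u j)\<^sup>2"
  have "(\<Sum>j<m. w j * ?t (trunc K u) v j) \<le> (\<Sum>j<m. w j * ?t u (trunc K' v) j)"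
  proof (rule sum_mono)
    fix j assume j: "j \<in> {..<m}"
    show "w j * ?t (trunc K u) v j \<le> w j * ?t u (trunc K' v) j"
    proof (cases "w j = 0")
      case False
      from cut[OF _ False] j consider "j < K" "j < K'" | "K < j" "K' \<le> j" by auto
      then show ?thesis
      proof cases
        case 1
        then have "link \<beta> (trunc K u) j = link \<beta> u j"
          by (cases j) (auto simp: link_def prev_def)
        then show ?thesis
          using 1 by simp
      next
        case 2
        then have "link \<beta> (trunc K u) j = 0"
          by (cases j) (auto simp: link_def prev_def)
        then show ?thesis
          using 2 w[of j] \<alpha> by simp
      qed
    qed simp
  qed
  moreover have "\<nu> / 2 * (norm (trunc K' v))\<^sup>2 \<le> \<nu> / 2 * (norm v)\<^sup>2"
    using trunc_pythagoras[of 0 K' v] \<nu> by (intro mult_left_mono) auto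
  moreover have "1 / (2 * \<gamma>) * (norm (y - trunc K' v))\<^sup>2 + 1 / (2 * \<gamma>) * (norm (v - trunc K' v))\<^sup>2
      = 1 / (2 * \<gamma>) * (norm (y - v))\<^sup>2"
    unfolding trunc_pythagoras[OF y, of v] by (simp add: distrib_left)
  moreover have "1 / (2 * \<gamma>) * (norm (x - trunc K u))\<^sup>2 + 1 / (2 * \<gamma>) * (norm (u - trunc K u))\<^sup>2
      = 1 / (2 * \<gamma>) * (norm (x - u))\<^sup>2"
    unfolding trunc_pythagoras[OF x, of u] by (simp add: distrib_left)
  ultimately show ?thesis
    unfolding prox_fun_def chain_fun_def fst_conv snd_conv by linarith
qed

text \<open>
  By the inequality above, replacing \<open>u\<close> by \<open>trunc K u\<close> lowers the best value of the maximising player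
  by at least a positive multiple of \<open>(norm (u - trunc K u))\<^sup>2\<close>, which contradicts the minimality of \<open>u\<close> unless \<open>u\<close> is
  truncated already; afterwards the same inequality forces \<open>v\<close> to be truncated.
\<close>

lemma minmax_point_chain:
  assumes w: "\<And>j. w j \<ge> 0" and \<alpha>: "\<alpha> \<ge> 0" and \<nu>: "\<nu> \<ge> 0" and \<gamma>: "\<gamma> > 0"
    and z: "z \<in> Rn K \<times> Rn K'"
    and cut: "\<And>j. j < m \<Longrightarrow> w j \<noteq> 0 \<Longrightarrow> j < K \<and> j < K' \<or> K < j \<and> K' \<le> j"
    and mm: "minmax_point (Rn m) (Rn m) (prox_fun (chain_fun m \<beta> \<alpha> lam \<nu> w) \<gamma> z) p"
  shows "p \<in> (Rn K \<inter> Rn m) \<times> (Rn K' \<inter> Rn m)"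
proof -
  obtain x y u v where xy: "z = (x, y)" and p: "p = (u, v)" by (cases z; cases p)
  let ?k = "prox_fun (chain_fun m \<beta> \<alpha> lam \<nu> w) \<gamma> (x, y)"
  have uv: "u \<in> Rn m" "v \<in> Rn m"
    and umin: "\<And>u'. u' \<in> Rn m \<Longrightarrow> (SUP v'\<in>Rn m. ereal (?k (u, v'))) \<le> (SUP v'\<in>Rn m. ereal (?k (u', v')))"
    and vmax: "\<And>v'. v' \<in> Rn m \<Longrightarrow> ?k (u, v') \<le> ?k (u, v)"
    using mm by (auto simp: minmax_point_def xy p)
  have xy': "x \<in> Rn K" "y \<in> Rn K'"
    using z xy by auto
  note key = prox_fun_chain_trunc[where w = w, OF w \<alpha> \<nu> \<gamma> xy' cut]
  let ?d = "1 / (2 * \<gamma>) * (norm (u - trunc K u))\<^sup>2" and ?e = "\<lambda>v. 1 / (2 * \<gamma>) * (norm (v - trunc K' v))\<^sup>2"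
  have e: "?e v' \<ge> 0" for v'
    using \<gamma> by simp
  have "ereal (?k (u, v)) \<le> (SUP v'\<in>Rn m. ereal (?k (u, v')))"
    by (rule SUP_upper) (rule uv)
  also have "\<dots> \<le> (SUP v'\<in>Rn m. ereal (?k (trunc K u, v')))"
    by (intro umin trunc_preserves_Rn uv)
  also have "\<dots> \<le> ereal (?k (u, v) - ?d)"
  proof (rule SUP_least)
    fix v' assume "v' \<in> Rn m"
    then have "?k (u, trunc K' v') \<le> ?k (u, v)"
      by (intro vmax trunc_preserves_Rn)
    then show "ereal (?k (trunc K u, v')) \<le> ereal (?k (u, v) - ?d)"
      using key[of m \<beta> lam u v'] e[of v'] by simp
  qed
  finally have "?d \<le> 0"
    by simp
  then have u: "trunc K u = u"
    using \<gamma> by (simp add: divide_le_0_iff)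
  have "?e v \<le> 0"
    using key[of m \<beta> lam u v] vmax[OF trunc_preserves_Rn[OF uv(2)], of K'] by (simp add: u)
  then have v: "trunc K' v = v"
    using \<gamma> by (simp add: divide_le_0_iff)
  show ?thesis
    using uv trunc_in_Rn[of K u] trunc_in_Rn[of K' v] by (simp add: p u v)
qed

lemma link_eq_0: "x \<in> Rn K \<Longrightarrow> K < j \<Longrightarrow> link \<beta> x j = 0"
  by (cases j) (auto simp: link_def prev_def coord_eq_Rn)

lemma chain_grad_support:
  assumes "z \<in> Rn (min K m) \<times> Rn (min K m)"
  shows "chain_grad m \<beta> \<alpha> lam \<nu> w z \<in> Rn (min (Suc K) m) \<times> Rn (min (Suc K) m)"
proof -
  have x: "fst z \<in> Rn K" and y: "snd z \<in> Rn K" and y': "snd z \<in> Rn m"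
    using assms by (auto simp flip: Rn_Int)
  have l: "link \<beta> (fst z) j = 0" if "j > K" for j
    using link_eq_0[OF x that] .
  have r: "chain_force m \<beta> \<alpha> lam w z j = 0" if "j > K" for j
    using that y l by (simp add: chain_force_def coord_eq_Rn)
  have "fst (chain_grad m \<beta> \<alpha> lam \<nu> w z) \<in> Rn (Suc K)" "snd (chain_grad m \<beta> \<alpha> lam \<nu> w z) \<in> Rn (Suc K)"
    using y by (auto simp: chain_grad_def Rn_def r l)
  moreover have "fst (chain_grad m \<beta> \<alpha> lam \<nu> w z) \<in> Rn m" "snd (chain_grad m \<beta> \<alpha> lam \<nu> w z) \<in> Rn m"
    using y' by (auto simp: chain_grad_def Rn_def)
  ultimately show ?thesis
    by (simp add: mem_Times_iff flip: Rn_Int)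
qed

lemma chain_grad_no_link:
  assumes "\<And>j. j < m \<Longrightarrow> w j = 0"
  shows "chain_grad m \<beta> \<alpha> lam \<nu> w z = (0, - \<nu> *\<^sub>R snd z)"
  using assms by (auto simp: chain_grad_def chain_force_def intro!: fvec_eqI)

lemma chain_weight_nonneg: "chain_weight n a b i j \<ge> 0"
  by (simp add: chain_weight_def)

lemma chain_weight_alternates: "a \<noteq> b \<Longrightarrow> chain_weight n a b i j = 0 \<or> chain_weight n a b i (Suc j) = 0"
  by (auto simp: chain_weight_def)

lemma chain_answers_inactive:
  assumes "i \<notin> {a, b}" "\<alpha> \<ge> 0" "\<nu> \<ge> 0" "K \<le> m" "K' \<le> m" and z: "z \<in> Rn K \<times> Rn K'"
  shows "answers_in (chain_problem n a b m \<beta> \<alpha> lam \<nu> X Y) i z (Rn K \<times> Rn K')"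
proof -
  let ?w = "chain_weight n a b i"
  have w: "?w j = 0" for j
    using assms(1) by (simp add: chain_weight_def)
  have zm: "z \<in> Rn m \<times> Rn m"
    using z Rn_mono[OF assms(4)] Rn_mono[OF assms(5)] by auto
  have "p \<in> Rn K \<times> Rn K'"
    if "\<gamma> > 0" "minmax_point (Rn m) (Rn m) (prox_fun (chain_fun m \<beta> \<alpha> lam \<nu> ?w) \<gamma> z) p" for \<gamma> p
    using minmax_point_chain[OF chain_weight_nonneg assms(2,3) that(1) z _ that(2)] w by auto
  then show ?thesis
    using z by (auto simp: answers_in_def gradx_def grady_def grad_chain[OF zm] chain_grad_no_link[OF w]
        subspace_scale[OF subspace_Rn])
qed

text \<open>
  A component holding the link \<open>K\<close> does not hold its successor, so that either \<open>K\<close> or \<open>Suc K\<close> is a cut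
  crossed by none of its links.  This is why two components are used: a proximal step on the whole
  chain could make all coordinates nonzero at once.
\<close>

lemma chain_answers_active:
  assumes "a \<noteq> b" "\<alpha> \<ge> 0" "\<nu> \<ge> 0" and z: "z \<in> Rn (min K m) \<times> Rn (min K m)"
  shows "answers_in (chain_problem n a b m \<beta> \<alpha> lam \<nu> X Y) i z (Rn (min (Suc K) m) \<times> Rn (min (Suc K) m))"
proof -
  let ?w = "chain_weight n a b i"
  have zm: "z \<in> Rn m \<times> Rn m" and zK: "z \<in> Rn K \<times> Rn K" and zK': "z \<in> Rn (Suc K) \<times> Rn (Suc K)"
    using z Rn_mono[of K "Suc K"] by (auto simp flip: Rn_Int)
  have "p \<in> Rn (min (Suc K) m) \<times> Rn (min (Suc K) m)"
    if p: "\<gamma> > 0" "minmax_point (Rn m) (Rn m) (prox_fun (chain_fun m \<beta> \<alpha> lam \<nu> ?w) \<gamma> z) p" for \<gamma> p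
  proof (cases "?w K = 0")
    case True
    then have "p \<in> (Rn K \<inter> Rn m) \<times> (Rn K \<inter> Rn m)"
      by (intro minmax_point_chain[OF chain_weight_nonneg assms(2,3) p(1) zK _ p(2)]) (metis le_refl linorder_neqE_nat less_imp_le)
    then show ?thesis
      using Rn_mono[of K "Suc K"] by (auto simp flip: Rn_Int)
  next
    case False
    then have "?w (Suc K) = 0"
      using chain_weight_alternates[OF assms(1)] by metis
    then have "p \<in> (Rn (Suc K) \<inter> Rn m) \<times> (Rn (Suc K) \<inter> Rn m)"
      by (intro minmax_point_chain[OF chain_weight_nonneg assms(2,3) p(1) zK' _ p(2)]) (metis le_refl linorder_neqE_nat less_imp_le)
    then show ?thesis
      by (simp add: Rn_Int)
  qed
  then show ?thesis
    using chain_grad_support[OF z, of \<beta> \<alpha> lam \<nu> ?w]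
    by (auto simp: answers_in_def gradx_def grady_def grad_chain[OF zm] mem_Times_iff subspace_neg[OF subspace_Rn])
qed

lemma chain_full_answers:
  assumes ab: "a \<in> {1..n}" "b \<in> {1..n}" "a \<noteq> b" and z: "z \<in> Rn (min K m) \<times> Rn (min K m)"
  shows "full_answers_in n (chain_problem n a b m \<beta> \<alpha> lam \<nu> X Y) z (Rn (min (Suc K) m) \<times> Rn (min (Suc K) m))"
proof -
  have zm: "z \<in> Rn m \<times> Rn m"
    using z by (auto simp flip: Rn_Int)
  show ?thesis
    using chain_grad_support[OF z, of \<beta> \<alpha> lam \<nu> "\<lambda>_. 1"]
    by (auto simp: full_answers_in_def gradx_def grady_def obj_chain[OF ab] grad_chain[OF zm] mem_Times_iff subspace_neg[OF subspace_Rn])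
qed

section \<open>The duality gap of the chain problem\<close>

lemma abs_link_le: "\<bar>link \<beta> x j\<bar> \<le> \<bar>\<beta>\<bar> + 2 * norm x"
proof -
  have "\<bar>prev \<beta> x j\<bar> \<le> \<bar>\<beta>\<bar> + norm x"
    by (cases j) (auto simp: prev_def intro: add_increasing abs_coord_le_norm)
  then show ?thesis
    using abs_coord_le_norm[of x j] by (simp add: link_def)
qed

lemma chain_fun_bounded:
  assumes "norm x \<le> B" "norm y \<le> C"
  shows "\<bar>chain_fun m \<beta> \<alpha> lam \<nu> (\<lambda>_. 1) (x, y)\<bar> \<le>
    real m * (\<bar>lam\<bar> * C * (\<bar>\<beta>\<bar> + 2 * B) + \<bar>\<alpha>\<bar> / 2 * (\<bar>\<beta>\<bar> + 2 * B)\<^sup>2) + \<bar>\<nu>\<bar> / 2 * C\<^sup>2"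
proof -
  have C: "C \<ge> 0"
    using assms(2) norm_ge_zero[of y] by linarith
  let ?l = "\<bar>\<beta>\<bar> + 2 * B"
  have l: "\<bar>link \<beta> x j\<bar> \<le> ?l" for j
    using abs_link_le[of \<beta> x j] assms by simp
  have "\<bar>lam * coord y j * link \<beta> x j + \<alpha> / 2 * (link \<beta> x j)\<^sup>2\<bar> \<le> \<bar>lam\<bar> * C * ?l + \<bar>\<alpha>\<bar> / 2 * ?l\<^sup>2" for j
  proof -
    have "\<bar>coord y j\<bar> \<le> C"
      using abs_coord_le_norm[of y j] assms by simp
    then have "\<bar>lam * coord y j * link \<beta> x j\<bar> \<le> \<bar>lam\<bar> * C * ?l"
      unfolding abs_mult using C by (intro mult_mono mult_nonneg_nonneg l) auto
    moreover have "(link \<beta> x j)\<^sup>2 \<le> ?l\<^sup>2"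
      using l[of j] by (simp add: abs_le_square_iff[symmetric])
    then have "\<bar>\<alpha> / 2 * (link \<beta> x j)\<^sup>2\<bar> \<le> \<bar>\<alpha>\<bar> / 2 * ?l\<^sup>2"
      by (simp add: abs_mult mult_left_mono)
    ultimately show ?thesis
      by linarith
  qed
  then have "\<bar>\<Sum>j<m. lam * coord y j * link \<beta> x j + \<alpha> / 2 * (link \<beta> x j)\<^sup>2\<bar>
      \<le> (\<Sum>j<m. \<bar>lam\<bar> * C * ?l + \<bar>\<alpha>\<bar> / 2 * ?l\<^sup>2)"
    by (intro order_trans[OF sum_abs] sum_mono)
  also have "\<dots> = real m * (\<bar>lam\<bar> * C * ?l + \<bar>\<alpha>\<bar> / 2 * ?l\<^sup>2)"
    by simp
  finally have "\<bar>\<Sum>j<m. lam * coord y j * link \<beta> x j + \<alpha> / 2 * (link \<beta> x j)\<^sup>2\<bar>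
      \<le> real m * (\<bar>lam\<bar> * C * ?l + \<bar>\<alpha>\<bar> / 2 * ?l\<^sup>2)" .
  moreover have "\<bar>\<nu> / 2 * (norm y)\<^sup>2\<bar> \<le> \<bar>\<nu>\<bar> / 2 * C\<^sup>2"
    using power_mono[OF assms(2) norm_ge_zero, of 2] by (simp add: abs_mult mult_left_mono)
  ultimately show ?thesis
    unfolding chain_fun_def fst_conv snd_conv mult_1 by linarith
qed

lemma phi_chain_ge:
  assumes ab: "a \<in> {1..n}" "b \<in> {1..n}" "a \<noteq> b" and Y: "bounded Y" "y \<in> Y"
  shows "chain_fun m \<beta> \<alpha> lam \<nu> (\<lambda>_. 1) (x, y) \<le> phi n (chain_problem n a b m \<beta> \<alpha> lam \<nu> X Y) x"
proof -
  obtain C where C: "\<And>y. y \<in> Y \<Longrightarrow> norm y \<le> C"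
    using Y(1) by (auto simp: bounded_iff)
  have "bdd_above ((\<lambda>y. chain_fun m \<beta> \<alpha> lam \<nu> (\<lambda>_. 1) (x, y)) ` Y)"
    by (rule bdd_aboveI2) (rule order_trans[OF abs_ge_self chain_fun_bounded[OF order_refl C]])
  from cSUP_upper[OF Y(2) this] show ?thesis
    by (simp add: phi_def obj_chain[OF ab])
qed

text \<open>
  At the constant vector \<open>\<beta>\<close> all links vanish, whatever \<open>y\<close> is.
\<close>

lemma psi_chain_le:
  assumes ab: "a \<in> {1..n}" "b \<in> {1..n}" "a \<noteq> b" and X: "bounded X" "vec m (\<lambda>_. \<beta>) \<in> X" and \<nu>: "\<nu> \<ge> 0"
  shows "psi n (chain_problem n a b m \<beta> \<alpha> lam \<nu> X Y) y \<le> 0"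
proof -
  obtain B where B: "\<And>x. x \<in> X \<Longrightarrow> norm x \<le> B"
    using X(1) by (auto simp: bounded_iff)
  have "bdd_below ((\<lambda>x. chain_fun m \<beta> \<alpha> lam \<nu> (\<lambda>_. 1) (x, y)) ` X)"
    by (rule bdd_belowI2) (rule iffD1[OF minus_le_iff abs_le_D2[OF chain_fun_bounded[OF B order_refl]]])
  from cINF_lower[OF this X(2)]
  have "psi n (chain_problem n a b m \<beta> \<alpha> lam \<nu> X Y) y \<le> chain_fun m \<beta> \<alpha> lam \<nu> (\<lambda>_. 1) (vec m (\<lambda>_. \<beta>), y)"
    by (simp add: psi_def obj_chain[OF ab])
  also have "\<dots> = - (\<nu> / 2 * (norm y)\<^sup>2)"
  proof -
    have "link \<beta> (vec m (\<lambda>_. \<beta>)) j = 0" if "j < m" for j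
      using that by (cases j) (auto simp: link_def prev_def)
    then show ?thesis
      by (simp add: chain_fun_def)
  qed
  also have "\<dots> \<le> 0"
    using \<nu> by simp
  finally show ?thesis .
qed

text \<open>
  If the last coordinate of \<open>x\<close> is zero, the links add up to \<open>\<beta>\<close>.  The bilinear part at a constant
  vector \<open>y\<close> sees exactly this sum, and the quadratic part is bounded by the Cauchy-Schwarz
  inequality.
\<close>

lemma chain_fun_ge:
  assumes m: "m \<ge> 1" and x: "coord x (m - 1) = 0" and \<alpha>: "\<alpha> \<ge> 0"
  shows "lam * t * \<beta> + \<alpha> * \<beta>\<^sup>2 / (2 * real m) - \<nu> / 2 * (real m * t\<^sup>2) \<le> chain_fun m \<beta> \<alpha> lam \<nu> (\<lambda>_. 1) (x, vec m (\<lambda>_. t))"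
proof -
  have "link \<beta> x j = prev \<beta> x j - prev \<beta> x (Suc j)" for j
    by (simp add: link_def prev_def)
  then have tele: "(\<Sum>j<m. link \<beta> x j) = \<beta>"
    using m x sum_lessThan_telescope'[of "prev \<beta> x" m] by (cases m) (auto simp: prev_def)
  then have "\<beta>\<^sup>2 \<le> (\<Sum>j<m. (link \<beta> x j)\<^sup>2) * m"
    using sum_squared_le_sum_of_squares[of "link \<beta> x" "{..<m}"] by simp
  then have "\<beta>\<^sup>2 / m \<le> (\<Sum>j<m. (link \<beta> x j)\<^sup>2)"
    using m by (simp add: divide_le_eq)
  then have "\<alpha> / 2 * (\<beta>\<^sup>2 / m) \<le> \<alpha> / 2 * (\<Sum>j<m. (link \<beta> x j)\<^sup>2)"
    using \<alpha> by (intro mult_left_mono) auto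
  moreover have "(\<Sum>j<m. lam * coord (vec m (\<lambda>_. t)) j * link \<beta> x j + \<alpha> / 2 * (link \<beta> x j)\<^sup>2)
      = lam * t * \<beta> + \<alpha> / 2 * (\<Sum>j<m. (link \<beta> x j)\<^sup>2)"
    by (simp add: sum.distrib tele mult.assoc flip: sum_distrib_left sum_divide_distrib)
  ultimately show ?thesis
    by (simp add: chain_fun_def norm_vec)
qed

section \<open>The two hard instances\<close>

text \<open>
  The optimal constant vector \<open>y\<close> in \<open>chain_fun_ge\<close> has the entries \<open>lam * \<beta> / (\<mu> * m)\<close>; the hypothesis
  \<open>Y\<close> makes it feasible, \<open>X\<close> does so for the minimiser \<open>(\<beta>, \<dots>, \<beta>)\<close>, and \<open>gap\<close>
  asks that the resulting bound on the gap be \<open>2 * \<epsilon>\<close> or more.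
\<close>

lemma chain_instance:
  fixes m n :: nat and Rx Ry \<alpha> \<beta> lam \<mu> L \<epsilon> :: real
  assumes A: "A \<in> PIFO n c0 (F_CC n Rx Ry L 0 \<mu>)" and c0: "c0 \<ge> 0"
    and ab: "a \<in> {1..n}" "b \<in> {1..n}" "a \<noteq> b"
    and rare: "pmf (samp A) a \<le> 2 / n" "pmf (samp A) b \<le> 2 / n"
    and pos: "\<epsilon> > 0" "\<mu> > 0" "Rx > 0" "Ry > 0" "\<alpha> \<ge> 0" "\<beta> \<ge> 0"
    and m: "m \<ge> 2"
    and smooth: "8 * real n * lam\<^sup>2 + 2 * \<mu>\<^sup>2 \<le> L\<^sup>2" "real n * (32 * \<alpha>\<^sup>2 + 8 * lam\<^sup>2) \<le> L\<^sup>2"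
    and X: "m * \<beta>\<^sup>2 \<le> Rx\<^sup>2" and Y: "lam\<^sup>2 * \<beta>\<^sup>2 / (\<mu>\<^sup>2 * m) \<le> Ry\<^sup>2"
    and gap: "2 * \<epsilon> \<le> (\<alpha> + lam\<^sup>2 / \<mu>) * \<beta>\<^sup>2 / (2 * real m)"
  shows "\<exists>P\<in>F_CC n Rx Ry L 0 \<mu>. ereal (n * (m - 1) / (2 * (4 + c0))) \<le> ereal_of_enat (run_time n A P \<epsilon>)"
proof -
  define P where "P = chain_problem n a b m \<beta> \<alpha> lam \<mu> (Bn m Rx) (Bn m Ry)"
  let ?U = "\<lambda>k. Rn (min (Suc k) m) \<times> Rn (min (Suc k) m)"
  have R: "0 \<le> Rx" "0 \<le> Ry" "0 \<le> \<mu>"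
    using pos by auto
  have P: "P \<in> F_CC n Rx Ry L 0 \<mu>"
    unfolding P_def using ab pos smooth Bn_props[OF R(1), of m] Bn_props[OF R(2), of m]
    by (intro chain_problem_in_F_CC chain_concave_in_y) auto
  \<comment> \<open>the initial full gradient already reaches the first coordinate, hence \<open>Suc k\<close>\<close>
  interpret zero_chain n P "{a, b}" ?U ?U
  proof
    fix k z
    show "subspace (?U k)"
      by (intro subspace_Times subspace_Rn)
    show "?U k \<subseteq> ?U (Suc k)"
      by (intro Sigma_mono Rn_mono) auto
    show "?U k \<subseteq> ?U k" "(0, 0) \<in> ?U 0"
      by auto
    show "(proj_on (setX P) (fst z), proj_on (setY P) (snd z)) \<in> ?U k" if "z \<in> ?U k"
      using that proj_on_Bn[OF R(1), of "fst z" "min (Suc k) m" m] proj_on_Bn[OF R(2), of "snd z" "min (Suc k) m" m]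
      by (auto simp: P_def Bn_def)
    show "answers_in P i z (?U k)" if "z \<in> ?U k" "i \<notin> {a, b}" for i
      unfolding P_def using that pos by (intro chain_answers_inactive) auto
    show "answers_in P i z (?U (Suc k))" if "z \<in> ?U k" for i
      unfolding P_def using that pos ab by (intro chain_answers_active) auto
    show "full_answers_in n P z (?U (Suc k))" if "z \<in> ?U k"
      unfolding P_def using that ab by (intro chain_full_answers) auto
    show "full_answers_in n P (0, 0) (?U 0)"
      unfolding P_def using ab by (intro chain_full_answers) auto
  qed
  have "norm (vec m (\<lambda>_. \<beta>)) \<le> Rx"
    by (rule power2_le_imp_le) (use X R in \<open>auto simp: norm_vec\<close>)
  then have opt: "vec m (\<lambda>_. \<beta>) \<in> Bn m Rx"
    by (simp add: Bn_def)
  have psi: "psi n P y \<le> 0" for y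
    unfolding P_def using ab opt R Bn_props by (intro psi_chain_le) auto
  have phi: "phi n P x \<ge> chain_fun m \<beta> \<alpha> lam \<mu> (\<lambda>_. 1) (x, y)" if "y \<in> Bn m Ry" for x y
    unfolding P_def using ab that R Bn_props by (intro phi_chain_ge) auto
  have mpos: "real m > 0"
    using m by simp
  have "ereal (n * (m - 1) / (2 * (4 + c0))) \<le> ereal_of_enat (run_time n A P \<epsilon>)"
  proof (rule run_time_ge[OF A P refl _ c0 rare pos(1)])
    show "0 < n" "0 < m - 1"
      using ab m by auto
    fix k x y assume xy: "(x, y) \<in> ?U k"
    have "0 \<le> chain_fun m \<beta> \<alpha> lam \<mu> (\<lambda>_. 1) (x, 0)"
      unfolding chain_fun_def using pos by (auto intro!: sum_nonneg)
    also have "\<dots> \<le> phi n P x"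
      by (rule phi) (rule Bn_props[OF R(2)])
    finally show "0 \<le> phi n P x - psi n P y"
      using psi[of y] by linarith
    assume k: "k < m - 1"
    \<comment> \<open>the maximiser of \<open>lam * t * \<beta> - \<mu> / 2 * (m * t\<^sup>2)\<close>\<close>
    define t where "t = lam * \<beta> / (\<mu> * m)"
    have t: "m * t\<^sup>2 = lam\<^sup>2 * \<beta>\<^sup>2 / (\<mu>\<^sup>2 * m)"
      using mpos pos by (simp add: t_def field_simps power2_eq_square)
    have "norm (vec m (\<lambda>_. t)) \<le> Ry"
      by (rule power2_le_imp_le) (use Y R in \<open>auto simp: norm_vec t\<close>)
    then have tY: "vec m (\<lambda>_. t) \<in> Bn m Ry"
      by (simp add: Bn_def)
    have x: "coord x (m - 1) = 0"
      using xy k by (auto intro: coord_eq_Rn[of x "Suc k"] simp flip: Rn_Int)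
    have "2 * \<epsilon> \<le> (\<alpha> + lam\<^sup>2 / \<mu>) * \<beta>\<^sup>2 / (2 * real m)"
      by (rule gap)
    also have "\<dots> = lam * t * \<beta> + \<alpha> * \<beta>\<^sup>2 / (2 * real m) - \<mu> / 2 * (real m * t\<^sup>2)"
      unfolding t unfolding t_def using mpos pos by (simp add: field_simps power2_eq_square)
    also have "\<dots> \<le> chain_fun m \<beta> \<alpha> lam \<mu> (\<lambda>_. 1) (x, vec m (\<lambda>_. t))"
      using m pos x by (intro chain_fun_ge) auto
    also have "\<dots> \<le> phi n P x"
      by (rule phi[OF tY])
    finally show "2 * \<epsilon> \<le> phi n P x - psi n P y"
      using psi[of y] by linarith
  qed
  with P show ?thesis
    by blast
qed

lemma concave_on_singleton: "concave_on {p} f"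
  unfolding concave_on_def
  by (rule convex_onI) (auto simp: scaleR_left_distrib[symmetric] algebra_simps)

text \<open>
  The objective is \<open>lam * y * (Rx - x)\<close> on the interval \<open>{-Rx..Rx}\<close> times the point \<open>y = D\<close>.  Its slope
  in \<open>x\<close> is proportional to \<open>y\<close>, so that \<open>D\<close> can make the gap at \<open>x = 0\<close> arbitrarily large, although
  the smoothness constant does not depend on \<open>D\<close>.  The gradient at the starting point has no
  \<open>x\<close>-part, since \<open>y = 0\<close> there, and the uninformative components are zero; so \<open>x\<close> stays
  \<open>0\<close> until the first informative sample.
\<close>

lemma hidden_slope_instance:
  fixes n :: nat and Rx Ry lam L \<epsilon> :: real
  assumes A: "A \<in> PIFO n c0 (F_CC n Rx Ry L 0 \<mu>)" and c0: "c0 \<ge> 0"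
    and ab: "a \<in> {1..n}" "b \<in> {1..n}" "a \<noteq> b"
    and rare: "pmf (samp A) a \<le> 2 / n" "pmf (samp A) b \<le> 2 / n"
    and pos: "\<epsilon> > 0" "Rx > 0" "Ry > 0" "lam > 0"
    and smooth: "8 * real n * lam\<^sup>2 \<le> L\<^sup>2"
  shows "\<exists>P\<in>F_CC n Rx Ry L 0 \<mu>. ereal (n / (2 * (4 + c0))) \<le> ereal_of_enat (run_time n A P \<epsilon>)"
proof -
  \<comment> \<open>the gap at \<open>x = 0\<close> is \<open>lam * D * Rx\<close>, which has to be \<open>2 * \<epsilon>\<close>\<close>
  define D where "D = 2 * \<epsilon> / (lam * Rx)"
  define y0 where "y0 = vec 1 (\<lambda>_. D)"
  define P where "P = chain_problem n a b 1 Rx 0 lam 0 (Bn 1 Rx) {y0}"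
  let ?U = "\<lambda>k. Rn (min k 1) \<times> Rn 1" and ?W = "\<lambda>k. Bn (min k 1) Rx \<times> {0, y0}"
  have R: "0 \<le> Rx" "0 \<le> Ry"
    using pos by auto
  have y0: "y0 \<in> Rn 1"
    by (simp add: y0_def)
  have P: "P \<in> F_CC n Rx Ry L 0 \<mu>"
    unfolding P_def using ab pos smooth y0 Bn_props[OF R(1), of 1]
    by (intro chain_problem_in_F_CC concave_on_singleton) auto
  have UW: "?W k \<subseteq> ?U k" for k
    using y0 by (auto simp: Bn_def)
  have U1: "?W k \<subseteq> Rn (min 1 1) \<times> Rn (min 1 1)" for k
    using UW[of k] Rn_mono[of "min k 1" 1] by auto
  \<comment> \<open>the \<open>y\<close>-coordinate is free from the beginning, and \<open>0\<close> is the infeasible starting value of \<open>y\<close>\<close>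
  interpret zero_chain n P "{a, b}" ?U ?W
  proof
    fix k z
    show "subspace (?U k)"
      by (intro subspace_Times subspace_Rn)
    show "?U k \<subseteq> ?U (Suc k)"
      by (intro Sigma_mono Rn_mono) auto
    show "?W k \<subseteq> ?U k"
      by (rule UW)
    show "(0, 0) \<in> ?W 0"
      using R by (simp add: Bn_props)
    show "(proj_on (setX P) (fst z), proj_on (setY P) (snd z)) \<in> ?W k" if "z \<in> ?U k"
      using that proj_on_Bn[OF R(1), of "fst z" "min k 1" 1] by (auto simp: P_def proj_on_singleton)
    show "answers_in P i z (?U k)" if "z \<in> ?W k" "i \<notin> {a, b}" for i
      unfolding P_def using that UW by (intro chain_answers_inactive) auto
    show "answers_in P i z (?U (Suc k))" if "z \<in> ?W k" for i
    proof -
      have "answers_in P i z (Rn (min (Suc 1) 1) \<times> Rn (min (Suc 1) 1))"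
        unfolding P_def using ab U1[of k] that by (intro chain_answers_active) auto
      then show ?thesis by simp
    qed
    show "full_answers_in n P z (?U (Suc k))" if "z \<in> ?W k"
    proof -
      have "full_answers_in n P z (Rn (min (Suc 1) 1) \<times> Rn (min (Suc 1) 1))"
        unfolding P_def using ab U1[of k] that by (intro chain_full_answers) auto
      then show ?thesis by simp
    qed
    have "chain_grad 1 Rx 0 lam 0 (\<lambda>_. 1) (0, 0) = (0, vec 1 (\<lambda>_. lam * Rx))"
      by (auto simp: chain_grad_def chain_force_def link_def prev_def intro!: fvec_eqI)
    then show "full_answers_in n P (0, 0) (?U 0)"
      by (simp add: P_def full_answers_in_def gradx_def grady_def obj_chain[OF ab] grad_chain subspace_neg[OF subspace_Rn])
  qed
  have "norm (vec 1 (\<lambda>_. Rx)) \<le> Rx"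
    by (rule power2_le_imp_le) (use R in \<open>auto simp: norm_vec\<close>)
  then have psi: "psi n P y \<le> 0" for y
    unfolding P_def using ab R Bn_props by (intro psi_chain_le) (auto simp: Bn_def)
  have phi: "phi n P x \<ge> lam * D * (Rx - coord x 0)" for x
  proof -
    have "lam * D * (Rx - coord x 0) = chain_fun 1 Rx 0 lam 0 (\<lambda>_. 1) (x, y0)"
      by (simp add: chain_fun_def y0_def link_def prev_def)
    also have "\<dots> \<le> phi n P x"
      unfolding P_def using ab by (intro phi_chain_ge) auto
    finally show ?thesis .
  qed
  have "ereal (n * (1::nat) / (2 * (4 + c0))) \<le> ereal_of_enat (run_time n A P \<epsilon>)"
  proof (rule run_time_ge[OF A P refl _ c0 rare pos(1)])
    show "0 < n" "0 < (1::nat)"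
      using ab by auto
    fix k x y assume xy: "(x, y) \<in> ?W k"
    then have "coord x 0 \<le> Rx"
      using abs_coord_le_norm[of x 0] by (auto simp: Bn_def)
    then have "0 \<le> lam * D * (Rx - coord x 0)"
      using pos by (auto simp: D_def)
    also note phi
    finally show "0 \<le> phi n P x - psi n P y"
      using psi[of y] by linarith
    assume "k < (1::nat)"
    with xy have "coord x 0 = 0"
      by (auto simp: Bn_def intro: coord_eq_Rn)
    then have "2 * \<epsilon> = lam * D * (Rx - coord x 0)"
      using pos by (simp add: D_def)
    also note phi
    finally show "2 * \<epsilon> \<le> phi n P x - psi n P y"
      using psi[of y] by linarith
  qed
  with P show ?thesis
    by auto
qed

section \<open>The lower bound\<close>

text \<open>
  Here \<open>x\<close> is the admissible length of the chain for \<open>\<alpha> = L / (8 * sqrt n)\<close> and \<open>lam = L / (4 * sqrt n)\<close>,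
  and the two rates come from dropping one of the summands under the root.  The scale in the
  logarithm is chosen such that \<open>ln t \<le> 2 * sqrt t\<close> gives the last bound.
\<close>

lemma rate_le_chain_length:
  fixes n L \<mu> R \<epsilon> :: real
  assumes pos: "n > 0" "L > 0" "\<mu> > 0" "R > 0" "\<epsilon> > 0"
  defines "x \<equiv> R / 2 * sqrt ((L / (8 * sqrt n) + (L / (4 * sqrt n))\<^sup>2 / \<mu>) / \<epsilon>)"
  shows "R * n powr (3/4) * sqrt (L / \<epsilon>) \<le> 6 * (n * x)"
    and "R * sqrt (n * L * (L / \<mu>) / \<epsilon>) \<le> 8 * (n * x)"
    and "n powr (3/4) * sqrt (L / \<mu>) * ln (R\<^sup>2 * L / (4 * sqrt n) / \<epsilon>) \<le> R * sqrt (n * L * (L / \<mu>) / \<epsilon>)"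
proof -
  \<comment> \<open>all quantities are monomials in \<open>q\<close>, \<open>sqrt (L / \<epsilon>)\<close> and \<open>sqrt (L / \<mu>)\<close>\<close>
  define q where "q = n powr (1/4)"
  have q: "q > 0"
    using pos by (simp add: q_def)
  have q2: "sqrt n = q\<^sup>2" and q3: "n powr (3/4) = q ^ 3" and q4: "n = q ^ 4"
    using pos by (simp_all add: q_def powr_half_sqrt[symmetric] powr_powr flip: powr_realpow)
  define r where "r = sqrt (L / \<epsilon>)"
  define k where "k = sqrt (L / \<mu>)"
  have rk: "r > 0" "k > 0" and r2: "r\<^sup>2 = L / \<epsilon>" and k2: "k\<^sup>2 = L / \<mu>"
    using pos by (auto simp: r_def k_def)
  have S: "(L / (8 * sqrt n) + (L / (4 * sqrt n))\<^sup>2 / \<mu>) / \<epsilon> = r\<^sup>2 / (8 * q\<^sup>2) + r\<^sup>2 * k\<^sup>2 / (16 * q ^ 4)"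
    unfolding r2 k2 q2 using pos q by (simp add: field_simps power2_eq_square power4_eq_xxxx)
  have "r / (3 * q) \<le> sqrt (r\<^sup>2 / (8 * q\<^sup>2) + r\<^sup>2 * k\<^sup>2 / (16 * q ^ 4))"
  proof (rule real_le_rsqrt)
    have "(r / (3 * q))\<^sup>2 \<le> r\<^sup>2 / (8 * q\<^sup>2)"
      using q rk by (simp add: power_divide power_mult_distrib frac_le)
    also have "\<dots> \<le> r\<^sup>2 / (8 * q\<^sup>2) + r\<^sup>2 * k\<^sup>2 / (16 * q ^ 4)"
      by simp
    finally show "(r / (3 * q))\<^sup>2 \<le> r\<^sup>2 / (8 * q\<^sup>2) + r\<^sup>2 * k\<^sup>2 / (16 * q ^ 4)" .
  qed
  then have "R / 2 * (r / (3 * q)) \<le> x"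
    unfolding x_def S using pos by (intro mult_left_mono) auto
  then have "n * (R / 2 * (r / (3 * q))) \<le> n * x"
    using pos by (intro mult_left_mono) auto
  then show "R * n powr (3/4) * sqrt (L / \<epsilon>) \<le> 6 * (n * x)"
    unfolding q3 r_def[symmetric] unfolding q4 using q by (simp add: field_simps power3_eq_cube power4_eq_xxxx)
  have C: "sqrt (n * L * (L / \<mu>) / \<epsilon>) = q\<^sup>2 * r * k"
  proof -
    have "n * L * (L / \<mu>) / \<epsilon> = (q\<^sup>2 * r * k)\<^sup>2"
      unfolding power_mult_distrib r2 k2 q4 by simp
    then show ?thesis
      using q rk by (simp only: real_sqrt_unique[OF refl]) simp
  qed
  have "r * k / (4 * q\<^sup>2) \<le> sqrt (r\<^sup>2 / (8 * q\<^sup>2) + r\<^sup>2 * k\<^sup>2 / (16 * q ^ 4))"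
    by (rule real_le_rsqrt) (simp add: power_divide power_mult_distrib)
  then have "R / 2 * (r * k / (4 * q\<^sup>2)) \<le> x"
    unfolding x_def S using pos by (intro mult_left_mono) auto
  then have "n * (R / 2 * (r * k / (4 * q\<^sup>2))) \<le> n * x"
    using pos by (intro mult_left_mono) auto
  also have "n * (R / 2 * (r * k / (4 * q\<^sup>2))) = R * (q\<^sup>2 * r * k) / 8"
    unfolding q4 using q by (simp add: field_simps power2_eq_square power4_eq_xxxx)
  finally show "R * sqrt (n * L * (L / \<mu>) / \<epsilon>) \<le> 8 * (n * x)"
    unfolding C by simp
  define u where "u = R * r / (2 * q)"
  have u: "u > 0"
    using pos q rk by (simp add: u_def)
  have "R\<^sup>2 * L / (4 * sqrt n) / \<epsilon> = u\<^sup>2"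
    unfolding u_def power_divide power_mult_distrib r2 q2 by simp
  then have "ln (R\<^sup>2 * L / (4 * sqrt n) / \<epsilon>) = 2 * ln u"
    using u by (simp add: ln_realpow)
  also have "\<dots> \<le> 2 * u"
    using ln_le_minus_one[OF u] by simp
  finally have "q ^ 3 * k * ln (R\<^sup>2 * L / (4 * sqrt n) / \<epsilon>) \<le> q ^ 3 * k * (2 * u)"
    using q rk by (intro mult_left_mono) auto
  also have "\<dots> = R * (q\<^sup>2 * r * k)"
    using q by (simp add: u_def field_simps power2_eq_square power3_eq_cube)
  finally show "n powr (3/4) * sqrt (L / \<mu>) * ln (R\<^sup>2 * L / (4 * sqrt n) / \<epsilon>) \<le> R * sqrt (n * L * (L / \<mu>) / \<epsilon>)"
    unfolding C q3 k_def[symmetric] .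
qed

text \<open>
  If \<open>x < 4\<close>, the chain may be too short to be of use, but then the whole bound is of order \<open>n\<close> and the
  instance with a single link suffices.  Otherwise rounding \<open>x\<close> down to \<open>m\<close> still leaves
  \<open>m - 1 \<ge> x / 2\<close>.
\<close>

lemma m_CC_lower_bound:
  fixes n :: nat and c0 L \<mu> Rx Ry \<epsilon> r x :: real
  assumes c0: "c0 > 0" and n: "n \<ge> 4" and pos: "L > 0" "\<mu> > 0" "Rx > 0" "Ry > 0" "\<epsilon> > 0"
    and \<kappa>: "L / \<mu> \<ge> 2" and \<epsilon>: "\<epsilon> \<le> \<mu> * Ry\<^sup>2 / 36"
    and x: "x = Rx / 2 * sqrt ((L / (8 * sqrt n) + (L / (4 * sqrt n))\<^sup>2 / \<mu>) / \<epsilon>)"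
    and r: "r \<le> n * (1 + 22 * x) / (400 * (4 + c0))"
  shows "ereal r \<le> ereal_of_enat (m_CC n c0 \<epsilon> Rx Ry L 0 \<mu>)"
proof (rule m_CC_ge)
  fix A assume A: "A \<in> PIFO n c0 (F_CC n Rx Ry L 0 \<mu>)"
  obtain a b where ab: "a \<in> {1..n}" "b \<in> {1..n}" "a \<noteq> b"
    and rare: "pmf (samp A) a \<le> 2 / n" "pmf (samp A) b \<le> 2 / n"
    using two_rare_indices[OF n] by metis
  define lam where "lam = L / (4 * sqrt n)"
  define \<alpha> where "\<alpha> = L / (8 * sqrt n)"
  define S where "S = \<alpha> + lam\<^sup>2 / \<mu>"
  have npos: "real n > 0"
    using n by simp
  have lam: "lam > 0" and \<alpha>: "\<alpha> > 0"
    using pos npos by (auto simp: lam_def \<alpha>_def)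
  have lam2: "real n * lam\<^sup>2 = L\<^sup>2 / 16" and \<alpha>2: "real n * \<alpha>\<^sup>2 = L\<^sup>2 / 64"
    using npos by (auto simp: lam_def \<alpha>_def power_divide power_mult_distrib)
  have smooth0: "8 * real n * lam\<^sup>2 \<le> L\<^sup>2"
    by (simp add: mult.assoc lam2)
  have S: "S > 0" "lam\<^sup>2 / \<mu> \<le> S"
    using pos \<alpha> by (auto simp: S_def add_pos_nonneg)
  have c: "0 < 4 + c0" "0 \<le> c0"
    using c0 by auto
  show "\<exists>P\<in>F_CC n Rx Ry L 0 \<mu>. ereal r \<le> ereal_of_enat (run_time n A P \<epsilon>)"
  proof (cases "x < 4")
    case True
    have "r \<le> n * 200 / (400 * (4 + c0))"
      using npos c by (intro order_trans[OF r] divide_right_mono mult_left_mono) (use True in auto)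
    also have "\<dots> = n / (2 * (4 + c0))"
      using c by (simp add: field_simps)
    finally have r': "r \<le> n / (2 * (4 + c0))" .
    obtain P where "P \<in> F_CC n Rx Ry L 0 \<mu>" "ereal (n / (2 * (4 + c0))) \<le> ereal_of_enat (run_time n A P \<epsilon>)"
      using hidden_slope_instance[OF A c(2) ab rare pos(5,3,4) lam smooth0] by auto
    then show ?thesis
      using r' by (meson ereal_less_eq(3) order_trans)
  next
    case False
    define m where "m = nat \<lfloor>x\<rfloor>"
    have m: "m \<ge> 2" "real m \<le> x" "x - 2 \<le> real (m - 1)"
      using False by (auto simp: m_def le_nat_floor) linarith+
    \<comment> \<open>the value for which the gap \<open>S * \<beta>\<^sup>2 / (2 * m)\<close> is exactly \<open>2 * \<epsilon>\<close>\<close>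
    define \<beta> where "\<beta> = sqrt (4 * \<epsilon> * m / S)"
    have mpos: "real m > 0"
      using m by simp
    have \<beta>2: "\<beta>\<^sup>2 = 4 * \<epsilon> * m / S"
      using pos S by (simp add: \<beta>_def)
    have \<beta>0: "\<beta> \<ge> 0"
      using pos S by (simp add: \<beta>_def)
    have X: "m * \<beta>\<^sup>2 \<le> Rx\<^sup>2"
    proof -
      have "(real m)\<^sup>2 \<le> x\<^sup>2"
        using m by (intro power_mono) auto
      also have "x\<^sup>2 = Rx\<^sup>2 * S / (4 * \<epsilon>)"
        unfolding x S_def \<alpha>_def[symmetric] lam_def[symmetric]
        using pos \<alpha> by (simp add: power_mult_distrib power_divide)
      finally show ?thesis
        unfolding \<beta>2 using pos S by (simp add: field_simps power2_eq_square)
    qed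
    have Y: "lam\<^sup>2 * \<beta>\<^sup>2 / (\<mu>\<^sup>2 * m) \<le> Ry\<^sup>2"
    proof -
      have "lam\<^sup>2 * \<beta>\<^sup>2 / (\<mu>\<^sup>2 * m) = (lam\<^sup>2 / \<mu>) / S * (4 * \<epsilon> / \<mu>)"
        unfolding \<beta>2 using pos S mpos by (simp add: field_simps power2_eq_square)
      also have "\<dots> \<le> 1 * (4 * \<epsilon> / \<mu>)"
      proof (rule mult_right_mono)
        show "(lam\<^sup>2 / \<mu>) / S \<le> 1"
          using S by (subst divide_le_eq_1_pos) auto
      qed (use pos in auto)
      also have "\<dots> \<le> Ry\<^sup>2"
        using pos \<epsilon> by (simp add: field_simps)
      finally show ?thesis .
    qed
    have gap: "2 * \<epsilon> \<le> (\<alpha> + lam\<^sup>2 / \<mu>) * \<beta>\<^sup>2 / (2 * real m)"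
      unfolding S_def[symmetric] \<beta>2 using S mpos by simp
    have smooth: "8 * real n * lam\<^sup>2 + 2 * \<mu>\<^sup>2 \<le> L\<^sup>2" "real n * (32 * \<alpha>\<^sup>2 + 8 * lam\<^sup>2) \<le> L\<^sup>2"
    proof -
      have "(2 * \<mu>)\<^sup>2 \<le> L\<^sup>2"
        using \<kappa> pos by (intro power_mono) (auto simp: field_simps)
      then show "8 * real n * lam\<^sup>2 + 2 * \<mu>\<^sup>2 \<le> L\<^sup>2"
        by (simp add: power_mult_distrib mult.assoc lam2)
      show "real n * (32 * \<alpha>\<^sup>2 + 8 * lam\<^sup>2) \<le> L\<^sup>2"
        using lam2 \<alpha>2 by (simp add: algebra_simps)
    qed
    obtain P where P: "P \<in> F_CC n Rx Ry L 0 \<mu>"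
      "ereal (n * (m - 1) / (2 * (4 + c0))) \<le> ereal_of_enat (run_time n A P \<epsilon>)"
      using chain_instance[OF A c(2) ab rare pos(5,2,3,4) less_imp_le[OF \<alpha>] \<beta>0 m(1) smooth X Y gap] by blast
    have "r \<le> n * (200 * real (m - 1)) / (400 * (4 + c0))"
      using npos c by (intro order_trans[OF r] divide_right_mono mult_left_mono) (use False m in auto)
    also have "\<dots> = n * (m - 1) / (2 * (4 + c0))"
      using c by (simp add: field_simps)
    finally show ?thesis
      using P by (meson ereal_less_eq(3) order_trans)
  qed
qed

theorem theorem5p2:
  fixes c0 :: real
  assumes "c0 > 0"
  shows "\<exists>c > 0. \<exists>c' > 0. \<forall>(n :: nat) (L :: real) (\<mu>y :: real) (Rx :: real) (Ry :: real).
    n \<ge> 4 \<and> L > 0 \<and> \<mu>y > 0 \<and> Rx > 0 \<and> Ry > 0 \<and> L / \<mu>y \<ge> 2 \<longrightarrow>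
    (\<exists>s > 0. \<forall>\<epsilon> > 0. \<epsilon> \<le> min (L * Rx\<^sup>2 / 4) (\<mu>y * Ry\<^sup>2 / 36) \<longrightarrow>
      (L / \<mu>y \<ge> c' * sqrt (real n) \<longrightarrow>
        ereal_of_enat (m_CC n c0 \<epsilon> Rx Ry L 0 \<mu>y) \<ge>
          ereal (c * (real n + Rx * real n powr (3/4) * sqrt (L / \<epsilon>)
                      + Rx * sqrt (real n * L * (L / \<mu>y) / \<epsilon>)
                      + real n powr (3/4) * sqrt (L / \<mu>y) * ln (s / \<epsilon>)))) \<and>
      (L / \<mu>y \<le> c' * sqrt (real n) \<longrightarrow>
        ereal_of_enat (m_CC n c0 \<epsilon> Rx Ry L 0 \<mu>y) \<ge>
          ereal (c * (real n + Rx * real n powr (3/4) * sqrt (L / \<epsilon>)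
                      + Rx * sqrt (real n * L * (L / \<mu>y) / \<epsilon>)))))"
proof -
  let ?c = "1 / (400 * (4 + c0))"
  have c: "?c > 0"
    using assms by simp
  have main: "\<exists>s > 0. \<forall>\<epsilon> > 0. \<epsilon> \<le> min (L * Rx\<^sup>2 / 4) (\<mu>y * Ry\<^sup>2 / 36) \<longrightarrow>
      ereal_of_enat (m_CC n c0 \<epsilon> Rx Ry L 0 \<mu>y) \<ge>
          ereal (?c * (real n + Rx * real n powr (3/4) * sqrt (L / \<epsilon>)
                      + Rx * sqrt (real n * L * (L / \<mu>y) / \<epsilon>)
                      + real n powr (3/4) * sqrt (L / \<mu>y) * ln (s / \<epsilon>))) \<and>
      ereal_of_enat (m_CC n c0 \<epsilon> Rx Ry L 0 \<mu>y) \<ge>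
          ereal (?c * (real n + Rx * real n powr (3/4) * sqrt (L / \<epsilon>)
                      + Rx * sqrt (real n * L * (L / \<mu>y) / \<epsilon>)))"
    if A: "n \<ge> 4 \<and> L > 0 \<and> \<mu>y > 0 \<and> Rx > 0 \<and> Ry > 0 \<and> L / \<mu>y \<ge> 2" for n :: nat and L \<mu>y Rx Ry :: real
  proof (intro exI[of _ "Rx\<^sup>2 * L / (4 * sqrt (real n))"] conjI allI impI)
    show "0 < Rx\<^sup>2 * L / (4 * sqrt (real n))"
      using A by simp
  next
    fix \<epsilon> :: real assume \<epsilon>: "\<epsilon> > 0" "\<epsilon> \<le> min (L * Rx\<^sup>2 / 4) (\<mu>y * Ry\<^sup>2 / 36)"
    define x where "x = Rx / 2 * sqrt ((L / (8 * sqrt n) + (L / (4 * sqrt n))\<^sup>2 / \<mu>y) / \<epsilon>)"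
    have n: "real n > 0"
      using A by simp
    have x0: "0 \<le> n * x"
      using A \<epsilon> by (simp add: x_def)
    note rate = rate_le_chain_length[OF n, of L \<mu>y Rx \<epsilon>, folded x_def]
    have bound: "ereal (?c * v) \<le> ereal_of_enat (m_CC n c0 \<epsilon> Rx Ry L 0 \<mu>y)" if "v \<le> n + 22 * (n * x)" for v
    proof (rule m_CC_lower_bound[OF assms _ _ _ _ _ _ _ _ x_def])
      have "?c * v \<le> ?c * (n + 22 * (n * x))"
        using that c by (intro mult_left_mono) auto
      also have "\<dots> = n * (1 + 22 * x) / (400 * (4 + c0))"
        by (simp add: algebra_simps)
      finally show "?c * v \<le> n * (1 + 22 * x) / (400 * (4 + c0))" .
    qed (use A \<epsilon> in auto)
    show "ereal (?c * (real n + Rx * real n powr (3/4) * sqrt (L / \<epsilon>)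
                      + Rx * sqrt (real n * L * (L / \<mu>y) / \<epsilon>)
                      + real n powr (3/4) * sqrt (L / \<mu>y) * ln (Rx\<^sup>2 * L / (4 * sqrt n) / \<epsilon>)))
      \<le> ereal_of_enat (m_CC n c0 \<epsilon> Rx Ry L 0 \<mu>y)"
      by (rule bound) (use rate A \<epsilon> in linarith)
    show "ereal (?c * (real n + Rx * real n powr (3/4) * sqrt (L / \<epsilon>)
                      + Rx * sqrt (real n * L * (L / \<mu>y) / \<epsilon>)))
      \<le> ereal_of_enat (m_CC n c0 \<epsilon> Rx Ry L 0 \<mu>y)"
      by (rule bound) (use rate(1,2) A \<epsilon> x0 in linarith)
  qed
  show ?thesis
  proof (rule exI[of _ ?c], intro conjI, rule c, rule exI[of _ "1::real"], intro conjI allI impI,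
      rule zero_less_one, goal_cases)
    case (1 n L \<mu>y Rx Ry)
    from main[OF 1] show ?case
      by blast
  qed
qed


end
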